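(* Let $1<\alpha<\infty$, let $k_0\ge 0$ be an integer, and let $\{s_n\}_{n\ge1}$ be a sequence of positive numbers with $s_n\ge k_0+n-1$ for all $n\geq 1$ and $s_n/n\to\alpha$. Let $\{Z_n\}_{n\ge 1}$ be the Markov chain with $Z_1=k_0$ and, for $n\ge1$, $$\Pr(Z_{n+1}-Z_n=1\mid Z_n)=1-\frac{Z_n}{s_n},\qquad \Pr(Z_{n+1}-Z_n=0\mid Z_n)=\frac{Z_n}{s_n}.$$ Then the sequence $Z_n/n$ satisfies the large deviation principle on $\mathbb{R}$ with speed $n$ and good strictly convex rate function $$I(x)=\sup_{\lambda\in\mathbb{R}}\{\lambda x-\Lambda(\lambda)\},$$ where the pressure $\Lambda(\lambda)=\lim_{n\to\infty}\frac1n\log E[e^{\lambda Z_n}]$ is given by $$\Lambda(\lambda)=-\log\left(\frac{\alpha}{e^\lambda-1}\int_0^\lambda\left(\frac{e^s-1}{e^\lambda-1}\right)^{\alpha-1}ds\right)\quad\text{for }\lambda\ne0,\qquad \Lambda(0)=0.$$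
   Context: A sequence $\{X_n\}$ of random variables with values in a separable complete metric space $\mathbf{X}$ satisfies the large deviation principle with speed $n$ and (good) rate function $I:\mathbf{X}\to[0,\infty]$ if the level sets $\{x: I(x)\le a\}$ are compact and for every Borel set $U\subset\mathbf{X}$, $$-\inf_{x\in U^\circ}I(x)\le\liminf_{n\to\infty}\frac1n\log\Pr(X_n\in U)\le\limsup_{n\to\infty}\frac1n\log\Pr(X_n\in U)\le-\inf_{x\in\bar U}I(x),$$ where $U^\circ$ is the interior and $\bar U$ the closure of $U$. Here $\mathbf{X}=\mathbb{R}$. Strict convexity of the $[0,\infty]$-valued function $I$ is understood on the set where $I$ is finite. The convention $0/0=0$ is used; since $Z_n\le k_0+n-1\le s_n$, the transition probabilities lie in $[0,1]$. *)

theory Defs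
  imports "HOL-Probability.Probability"
begin

text \<open>
  Discrete-time Markov chain indexed from 1 (the value at index 0 is irrelevant), with countable
  state space and possibly time-inhomogeneous transitions.  Only conditioning events of positive
  probability are constrained.
\<close>

definition markov_chain :: "'w measure \<Rightarrow> (nat \<Rightarrow> 'w \<Rightarrow> 's::countable) \<Rightarrow> bool" where
  "markov_chain M Z \<longleftrightarrow>
     prob_space M \<and>
     (\<forall>n\<ge>1. Z n \<in> measurable M (count_space UNIV)) \<and>
     (\<forall>n\<ge>1. \<forall>x y. \<P>(\<omega> in M. \<forall>k\<in>{1..n}. Z k \<omega> = x k) > 0 \<longrightarrow>
        \<P>(\<omega> in M. Z (Suc n) \<omega> = y \<bar> \<forall>k\<in>{1..n}. Z k \<omega> = x k) =
        \<P>(\<omega> in M. Z (Suc n) \<omega> = y \<bar> Z n \<omega> = x n))"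

text \<open>Logarithm on \<open>[0, \<infinity>)\<close> with the convention \<open>log 0 = -\<infinity>\<close>.\<close>

definition ext_ln :: "real \<Rightarrow> ereal" where
  "ext_ln p = (if p > 0 then ereal (ln p) else - \<infinity>)"

definition good_rate_function :: "('x::topological_space \<Rightarrow> ereal) \<Rightarrow> bool" where
  "good_rate_function I \<longleftrightarrow> (\<forall>x. 0 \<le> I x) \<and> (\<forall>a::real. compact {x. I x \<le> ereal a})"

text \<open>
  Large deviation principle with speed \<open>n\<close>.  The infimum over the empty set is \<open>\<infinity>\<close>; the
  term with \<open>n = 0\<close> does not affect the lower and upper limits.
\<close>

definition large_deviation_principle ::
  "'w measure \<Rightarrow> (nat \<Rightarrow> 'w \<Rightarrow> 'x::polish_space) \<Rightarrow> ('x \<Rightarrow> ereal) \<Rightarrow> bool" where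
  "large_deviation_principle M X I \<longleftrightarrow>
     (\<forall>n\<ge>1. X n \<in> borel_measurable M) \<and>
     good_rate_function I \<and>
     (\<forall>U\<in>sets borel.
        - (INF x\<in>interior U. I x)
          \<le> liminf (\<lambda>n. ext_ln (\<P>(\<omega> in M. X n \<omega> \<in> U)) / ereal (real n)) \<and>
        limsup (\<lambda>n. ext_ln (\<P>(\<omega> in M. X n \<omega> \<in> U)) / ereal (real n))
          \<le> - (INF x\<in>closure U. I x))"

text \<open>Strict convexity, on the set where it is finite, of a function with values in \<open>[0, \<infinity>]\<close>.\<close>

definition strictly_convex_where_finite :: "('x::real_vector \<Rightarrow> ereal) \<Rightarrow> bool" where
  "strictly_convex_where_finite f \<longleftrightarrow>
     (\<forall>x y. \<forall>t::real. f x < \<infinity> \<and> f y < \<infinity> \<and> x \<noteq> y \<and> 0 < t \<and> t < 1 \<longrightarrow>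
        f ((1 - t) *\<^sub>R x + t *\<^sub>R y) < ereal (1 - t) * f x + ereal t * f y)"

definition scaled_log_mgf :: "'w measure \<Rightarrow> (nat \<Rightarrow> 'w \<Rightarrow> real) \<Rightarrow> real \<Rightarrow> nat \<Rightarrow> real" where
  "scaled_log_mgf M Y \<theta> n = 1 / real n * ln (\<integral>\<omega>. exp (\<theta> * Y n \<omega>) \<partial>M)"

text \<open>Only meaningful where the limit exists; convergence has to be stated separately.\<close>

definition pressure :: "'w measure \<Rightarrow> (nat \<Rightarrow> 'w \<Rightarrow> real) \<Rightarrow> real \<Rightarrow> real" where
  "pressure M Y \<theta> = lim (scaled_log_mgf M Y \<theta>)"

definition legendre_transform :: "(real \<Rightarrow> real) \<Rightarrow> real \<Rightarrow> ereal" where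
  "legendre_transform \<Lambda> x = (SUP \<theta>. ereal (\<theta> * x - \<Lambda> \<theta>))"

end

theory Submission
  imports Defs "HOL-Real_Asymp.Real_Asymp"
begin

text \<open>
  Let \<open>L\<^sub>n = log E exp (x Z\<^sub>n)\<close>. The transition probabilities give
  \<open>L\<^sub>n\<^sub>+\<^sub>1 = L\<^sub>n + log (e\<^sup>x - (e\<^sup>x - 1) L\<^sub>n' / s\<^sub>n)\<close>, and \<open>n \<Lambda>\<close> solves this recursion
  asymptotically because \<open>e\<^sup>\<Lambda> = e\<^sup>x - (e\<^sup>x - 1) \<Lambda>' / \<alpha>\<close>. If \<open>L\<^sub>n'\<close> is replaced by the difference
  quotient over \<open>[(1 - \<epsilon>) x, x]\<close>, i.e. towards the fixed point 0, the recursion becomes monotone and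
  \<open>sup |L\<^sub>n - n \<Lambda>|\<close> over a compact interval grows by at most a small constant per step. The error of
  the replacement is controlled by \<open>0 \<le> L\<^sub>n'' \<le> L\<^sub>n'\<close>: the variance of every exponential tilting of
  \<open>Z\<^sub>n\<close> is at most its mean because \<open>k! P(Z\<^sub>n = k)\<close> is log-concave in \<open>k\<close>, a property that the
  recursion preserves. The large deviation principle then follows from the differentiability of
  \<open>\<Lambda>\<close> as in the Gaertner-Ellis theorem, and strict convexity holds because every point strictly
  between two points of finiteness of the Legendre transform is a value of \<open>\<Lambda>'\<close>.
\<close>

text \<open>The obstacle is that the recursion feeds on the derivative of \<open>L\<^sub>n\<close>,
  so uniform closeness of \<open>L\<^sub>n\<close> to \<open>n \<Lambda>\<close> does not propagate
  by itself. Taking the difference quotient towards 0 helps twice: with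
  \<open>h = \<epsilon> x\<close> the coefficient \<open>(e\<^sup>x - 1) / (s\<^sub>n h)\<close> is
  nonnegative on both sides of 0, and \<open>(1 - \<epsilon>) x\<close> stays in the same interval
  [-K, K], so no boundary data are needed. Monotonicity is then a Courant condition,
  \<open>s\<^sub>n \<epsilon> \<ge> e\<^sup>2\<^sup>K\<close>; for fixed \<epsilon> it holds from
  some n on because \<open>s\<^sub>n\<close> grows linearly. The price is the error of the
  difference quotient, divided by \<open>s\<^sub>n\<close>. A variable with values in {0, ..., k0 +
  n} may have variance of order n^2, which would make this error useless; a variance of order n
  makes it O(\<epsilon>) uniformly in n. This is what the variance bound is for. The formula for
  \<Lambda> comes from F = exp(-\<Lambda>), which turns the nonlinear equation into the linear one
  \<open>e\<^sup>x F + (e\<^sup>x - 1) F' / \<alpha> = 1\<close>. Its coefficient degenerates at 0,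
  and the integral used here is the solution that is smooth there.\<close>

section \<open>A monotone upwind scheme\<close>

lemma abs_ln_diff_le:
  fixes a b m :: real
  assumes "0 < m" "m \<le> a" "m \<le> b"
  shows "\<bar>ln a - ln b\<bar> \<le> \<bar>a - b\<bar> / m"
proof -
  have *: "ln x - ln y \<le> \<bar>x - y\<bar> / m" if "m \<le> x" "m \<le> y" for x y :: real
  proof -
    have "ln x - ln y = ln (x / y)" using assms that by (simp add: ln_div)
    also have "\<dots> \<le> x / y - 1" using assms that by (intro ln_le_minus_one) auto
    also have "\<dots> = (x - y) / y" using assms that by (simp add: field_simps)
    also have "\<dots> \<le> \<bar>x - y\<bar> / y" using assms that by (intro divide_right_mono) auto
    also have "\<dots> \<le> \<bar>x - y\<bar> / m" using assms that by (intro divide_left_mono) auto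
    finally show ?thesis .
  qed
  from *[OF assms(2,3)] *[OF assms(3,2)] show ?thesis by (simp add: abs_le_iff abs_minus_commute)
qed

text \<open>Moment generating function \<open>(1 - p) * exp x + p\<close> of an increment that is 0
  with probability \<open>p\<close> and 1 otherwise. In the recursion \<open>p\<close> is the mean
  of \<open>Z\<^sub>n / s\<^sub>n\<close> under the law tilted by
  \<open>exp (x * Z\<^sub>n)\<close>.\<close>

definition step_factor :: "real \<Rightarrow> real \<Rightarrow> real" where
  "step_factor x p = exp x - (exp x - 1) * p"

lemma step_factor_ge:
  assumes "\<bar>x\<bar> \<le> K" "0 \<le> p" "p \<le> 1"
  shows "exp (- K) \<le> step_factor x p"
proof -
  have "exp (- K) \<le> exp x" "exp (- K) \<le> 1" using assms by auto
  then have "(1 - p) * exp (- K) + p * exp (- K) \<le> (1 - p) * exp x + p * 1"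
    using assms by (intro add_mono mult_left_mono) auto
  then show ?thesis by (simp add: step_factor_def algebra_simps)
qed

lemma abs_exp_minus_one_le:
  fixes x :: real assumes "\<bar>x\<bar> \<le> K" shows "\<bar>exp x - 1\<bar> \<le> exp K * \<bar>x\<bar>"
proof (cases "x \<ge> 0")
  case True
  have "exp x * (1 - x) \<le> exp x * exp (- x)"
    using exp_ge_add_one_self[of "- x"] by (intro mult_left_mono) auto
  then have "exp x - 1 \<le> exp x * x" by (simp add: exp_minus algebra_simps)
  also have "\<dots> \<le> exp K * x" using True assms by (intro mult_right_mono) auto
  finally show ?thesis using True by simp
next
  case False
  have "1 - exp x \<le> 1 * (- x)" using exp_ge_add_one_self[of x] by linarith
  also have "\<dots> \<le> exp K * (- x)" using False assms by (intro mult_right_mono) auto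
  finally show ?thesis using False by simp
qed

text \<open>The constant is the bound \<open>exp K * K\<close> for \<bar>exp x - 1\<bar>, divided by
  the common lower bound \<open>exp (- K)\<close> of the two factors.\<close>

lemma abs_ln_step_factor_diff_le:
  assumes "\<bar>x\<bar> \<le> K" "0 \<le> p" "p \<le> 1" "0 \<le> q" "q \<le> 1"
  shows "\<bar>ln (step_factor x p) - ln (step_factor x q)\<bar> \<le> K * exp (2 * K) * \<bar>p - q\<bar>"
proof -
  have "step_factor x p - step_factor x q = (exp x - 1) * (q - p)"
    by (simp add: step_factor_def algebra_simps)
  then have "\<bar>step_factor x p - step_factor x q\<bar> = \<bar>exp x - 1\<bar> * \<bar>p - q\<bar>"
    by (simp add: abs_mult abs_minus_commute)
  also have "\<dots> \<le> (exp K * K) * \<bar>p - q\<bar>"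
  proof (rule mult_right_mono)
    have "exp K * \<bar>x\<bar> \<le> exp K * K" using assms(1) by simp
    then show "\<bar>exp x - 1\<bar> \<le> exp K * K" using abs_exp_minus_one_le[OF assms(1)] by linarith
  qed simp
  finally have "\<bar>step_factor x p - step_factor x q\<bar> / exp (- K) \<le> (exp K * K) * \<bar>p - q\<bar> / exp (- K)"
    by (intro divide_right_mono) auto
  also have "\<dots> = K * exp (2 * K) * \<bar>p - q\<bar>"
    by (simp add: exp_minus field_simps exp_add[symmetric])
  finally show ?thesis
    using abs_ln_diff_le[OF exp_gt_zero step_factor_ge[OF assms(1-3)] step_factor_ge[OF assms(1,4,5)]]
    by linarith
qed

text \<open>Concavity of the logarithm makes the upwind scheme monotone as soon as \<open>c \<le> exp (- K)\<close>.\<close>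

lemma upwind_step_diff_le:
  assumes x: "\<bar>x\<bar> \<le> K" and c: "0 \<le> c" "c \<le> exp (- K)" "exp x - 1 = c * r"
    and p: "r * p = u - w" "0 \<le> p" "p \<le> 1" and q: "r * q = u' - w'" "0 \<le> q" "q \<le> 1"
    and M: "u - u' \<le> m" "w - w' \<le> m"
  shows "u + ln (step_factor x p) - (u' + ln (step_factor x q)) \<le> m"
proof -
  define A B where "A = step_factor x p" and "B = step_factor x q"
  have A: "exp (- K) \<le> A" and B: "exp (- K) \<le> B"
    unfolding A_def B_def using step_factor_ge x p q by auto
  have pos: "0 < A" "0 < B" using A B exp_gt_zero[of "-K"] by linarith+
  have "ln A - ln B = ln (A / B)" using pos by (simp add: ln_div)
  also have "\<dots> \<le> A / B - 1" using pos by (intro ln_le_minus_one) auto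
  also have "\<dots> = (A - B) / B" using pos by (simp add: field_simps)
  also have "A - B = c * (r * q - r * p)"
    unfolding A_def B_def step_factor_def c(3) by (simp add: algebra_simps)
  also have "r * q - r * p = (w - w') - (u - u')" unfolding p q by simp
  finally have "ln A - ln B \<le> c / B * ((w - w') - (u - u'))" by simp
  also have "\<dots> \<le> c / B * (m - (u - u'))"
    using M c pos by (intro mult_left_mono) auto
  \<comment> \<open>The Courant condition enters here: \<open>c \<le> exp (- K) \<le> B\<close>.
    With factor 1 the term \<open>u - u'\<close> cancels, so the bound \<open>m\<close> does not
    grow.\<close>
  also have "\<dots> \<le> 1 * (m - (u - u'))"
    using M c pos B by (intro mult_right_mono) (auto simp: field_simps)
  finally show ?thesis unfolding A_def B_def by simp
qed

lemma upwind_step_abs_diff_le: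
  assumes x: "\<bar>x\<bar> \<le> K" and c: "0 \<le> c" "c \<le> exp (- K)" "exp x - 1 = c * r"
    and p: "r * p = u - w" "0 \<le> p" "p \<le> 1" and q: "r * q = u' - w'" "0 \<le> q" "q \<le> 1"
    and M: "\<bar>u - u'\<bar> \<le> m" "\<bar>w - w'\<bar> \<le> m"
  shows "\<bar>u + ln (step_factor x p) - (u' + ln (step_factor x q))\<bar> \<le> m"
  using upwind_step_diff_le[OF x c p q, of m] upwind_step_diff_le[OF x c q p, of m] M
  by (simp add: abs_le_iff)

text \<open>Three errors are added: \<open>\<epsilon> * K\<close> for replacing \<open>v x\<close>
  by a difference quotient of \<open>L\<close>, none for the monotone step applied to
  \<open>L\<close> and to \<open>n \<Lambda>\<close>, and
  \<open>\<delta> + \<bar>n / s - 1 / \<alpha>\<bar>\<close> because \<open>n \<Lambda>\<close>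
  solves the scheme only approximately. At \<open>x = 0\<close> the quotient degenerates, but both
  functions vanish there.\<close>

lemma upwind_error:
  fixes L L' v :: "real \<Rightarrow> real" and \<Lambda> D :: "real \<Rightarrow> real" and n :: nat
  assumes K: "0 < K" "\<bar>x\<bar> \<le> K" and \<epsilon>: "0 < \<epsilon>" "\<epsilon> < 1" and n: "n \<ge> 1"
    and s: "real n \<le> s" "exp (2 * K) \<le> s * \<epsilon>"
    and \<alpha>: "1 < \<alpha>"
    and L: "\<And>x. (L has_real_derivative v x) (at x)" "L 0 = 0"
    and v: "\<And>x. 0 \<le> v x" "\<And>x. v x \<le> s" "\<And>x y. \<bar>v x - v y\<bar> \<le> s * \<bar>x - y\<bar>"
    and L': "L' x = L x + ln (step_factor x (v x / s))"
    and \<Lambda>: "\<And>x. (\<Lambda> has_real_derivative D x) (at x)" "\<Lambda> 0 = 0"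
    and D: "\<And>x. 0 \<le> D x" "\<And>x. D x \<le> 1" "\<And>x. \<Lambda> x = ln (step_factor x (D x / \<alpha>))"
    and uc: "\<And>y. \<bar>y - x\<bar> \<le> \<epsilon> * K \<Longrightarrow> \<bar>D y - D x\<bar> \<le> \<delta>"
    and M: "\<And>y. \<bar>y\<bar> \<le> K \<Longrightarrow> \<bar>L y - real n * \<Lambda> y\<bar> \<le> m"
  shows "\<bar>L' x - real (Suc n) * \<Lambda> x\<bar>
    \<le> m + K * exp (2 * K) * (\<epsilon> * K + \<delta> + \<bar>real n / s - 1 / \<alpha>\<bar>)"
proof (cases "x = 0")
  case True
  have "0 \<le> \<delta>" using uc[of x] K \<epsilon> by simp
  moreover have "0 \<le> m" using M[of 0] K by (simp add: L \<Lambda>)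
  moreover have "L' x = 0" unfolding L' by (simp add: True L step_factor_def)
  ultimately show ?thesis using True K \<epsilon> by (simp add: \<Lambda>)
next
  case False
  \<comment> \<open>\<open>h\<close> has the sign of \<open>x\<close>, so \<open>y\<close> lies
    between 0 and \<open>x\<close> and the bound \<open>m\<close> is available at both
    points.\<close>
  define h y where "h = \<epsilon> * x" and "y = x - h"
  have spos: "0 < s" using s n by linarith
  have h: "h \<noteq> 0" "\<bar>h\<bar> \<le> \<epsilon> * K" using False \<epsilon> K by (auto simp: h_def abs_mult)
  have yx: "y = (1 - \<epsilon>) * x" by (simp add: y_def h_def algebra_simps)
  have "\<bar>y\<bar> \<le> 1 * \<bar>x\<bar>" unfolding yx abs_mult using \<epsilon> by (intro mult_right_mono) auto
  then have yK: "\<bar>y\<bar> \<le> K" using K by simp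
  have mvt: "\<exists>\<xi>. \<bar>\<xi> - x\<bar> \<le> \<epsilon> * K \<and> f x - f y = h * f' \<xi>"
    if der: "\<And>x. (f has_real_derivative f' x) (at x)" for f f' :: "real \<Rightarrow> real"
  proof (cases "y < x")
    case True
    obtain \<xi> where "y < \<xi>" "\<xi> < x" "f x - f y = (x - y) * f' \<xi>"
      using MVT2[of y x f f', OF True der] by auto
    then show ?thesis using h by (intro exI[of _ \<xi>]) (auto simp: y_def)
  next
    case False
    then have "x < y" using h by (simp add: y_def)
    obtain \<xi> where "x < \<xi>" "\<xi> < y" "f y - f x = (y - x) * f' \<xi>"
      using MVT2[of x y f f', OF \<open>x < y\<close> der] by auto
    then show ?thesis using h by (intro exI[of _ \<xi>]) (auto simp: y_def)
  qed
  obtain \<xi> where \<xi>: "\<bar>\<xi> - x\<bar> \<le> \<epsilon> * K" "L x - L y = h * v \<xi>" using mvt[OF L(1)] by blast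
  obtain \<zeta> where \<zeta>: "\<bar>\<zeta> - x\<bar> \<le> \<epsilon> * K" "\<Lambda> x - \<Lambda> y = h * D \<zeta>" using mvt[OF \<Lambda>(1)] by blast
  \<comment> \<open>The Courant number. Numerator and denominator have the same sign, and its size
    is at most \<open>exp K / (s * \<epsilon>)\<close>.\<close>
  define c where "c = (exp x - 1) / (s * h)"
  have c0: "0 \<le> c"
  proof (cases "x > 0")
    case True then show ?thesis using \<epsilon> spos by (simp add: c_def h_def)
  next
    case F: False
    then have "exp x - 1 \<le> 0" "s * h \<le> 0" using \<epsilon> spos by (auto simp: h_def mult_le_0_iff)
    then show ?thesis unfolding c_def by (rule divide_nonpos_nonpos)
  qed
  have c1: "c \<le> exp (- K)"
  proof -
    have "c = \<bar>exp x - 1\<bar> / (s * \<epsilon> * \<bar>x\<bar>)"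
      using c0 spos \<epsilon> by (metis abs_divide abs_mult abs_of_nonneg abs_of_pos c_def h_def mult.assoc)
    also have "\<dots> \<le> exp K * \<bar>x\<bar> / (s * \<epsilon> * \<bar>x\<bar>)"
      using abs_exp_minus_one_le[OF K(2)] spos \<epsilon> by (intro divide_right_mono) auto
    also have "\<dots> = exp K / (s * \<epsilon>)" using False by simp
    also have "\<dots> \<le> exp K / exp (2 * K)" using s spos \<epsilon> by (intro divide_left_mono) auto
    also have "\<dots> = exp (- K)" by (simp add: exp_diff[symmetric])
    finally show ?thesis .
  qed
  have ceq: "exp x - 1 = c * (s * h)" using spos h by (simp add: c_def)
  have n1: "real n / s \<le> 1" using s spos by (simp add: field_simps)
  \<comment> \<open>Chosen so that \<open>s * h * q\<close> is exactly the increment of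
    \<open>n \<Lambda>\<close> from \<open>y\<close> to \<open>x\<close>; \<open>n \<le> s\<close>
    keeps it a probability.\<close>
  define q where "q = real n / s * D \<zeta>"
  have q: "0 \<le> q" "q \<le> 1" unfolding q_def using D(1)[of \<zeta>] spos mult_le_one[OF n1 D(1,2)] by auto
  have p: "0 \<le> v z / s" "v z / s \<le> 1" for z using v spos by (auto simp: field_simps)
  have d: "0 \<le> D x / \<alpha>" "D x / \<alpha> \<le> 1" using D(1,2)[of x] \<alpha> by (auto simp: field_simps)
  let ?C = "K * exp (2 * K)"
  have C: "0 \<le> ?C" using K by simp
  have 1: "\<bar>ln (step_factor x (v x / s)) - ln (step_factor x (v \<xi> / s))\<bar> \<le> ?C * (\<epsilon> * K)"
  proof -
    have "\<bar>v x / s - v \<xi> / s\<bar> = \<bar>v \<xi> - v x\<bar> / s"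
      using spos by (simp add: diff_divide_distrib[symmetric] abs_minus_commute)
    also have "\<dots> \<le> \<bar>\<xi> - x\<bar>" using v(3)[of \<xi> x] spos by (simp add: field_simps)
    finally have "\<bar>v x / s - v \<xi> / s\<bar> \<le> \<epsilon> * K" using \<xi> by linarith
    then have "?C * \<bar>v x / s - v \<xi> / s\<bar> \<le> ?C * (\<epsilon> * K)" using C by (rule mult_left_mono)
    then show ?thesis using abs_ln_step_factor_diff_le[OF K(2) p(1)[of x] p(2)[of x] p(1)[of \<xi>] p(2)[of \<xi>]]
      by linarith
  qed
  have 2: "\<bar>L x + ln (step_factor x (v \<xi> / s)) - (real n * \<Lambda> x + ln (step_factor x q))\<bar> \<le> m"
  proof (rule upwind_step_abs_diff_le[OF K(2) c0 c1 ceq _ p _ q])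
    show "s * h * (v \<xi> / s) = L x - L y" using spos \<xi> by simp
    show "s * h * q = real n * \<Lambda> x - real n * \<Lambda> y"
      using spos \<zeta> by (simp add: q_def right_diff_distrib[symmetric])
    show "\<bar>L x - real n * \<Lambda> x\<bar> \<le> m" using M K by simp
    show "\<bar>L y - real n * \<Lambda> y\<bar> \<le> m" using M yK by simp
  qed
  have 3: "\<bar>ln (step_factor x q) - \<Lambda> x\<bar> \<le> ?C * (\<delta> + \<bar>real n / s - 1 / \<alpha>\<bar>)"
  proof -
    have "q - D x / \<alpha> = real n / s * (D \<zeta> - D x) + (real n / s - 1 / \<alpha>) * D x"
      by (simp add: q_def algebra_simps)
    then have "\<bar>q - D x / \<alpha>\<bar> \<le> \<bar>real n / s * (D \<zeta> - D x)\<bar> + \<bar>(real n / s - 1 / \<alpha>) * D x\<bar>"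
      using abs_triangle_ineq by metis
    also have "\<dots> = real n / s * \<bar>D \<zeta> - D x\<bar> + \<bar>real n / s - 1 / \<alpha>\<bar> * D x"
      using spos D(1)[of x] by (simp add: abs_mult)
    also have "\<dots> \<le> 1 * \<delta> + \<bar>real n / s - 1 / \<alpha>\<bar> * 1"
      using uc[OF \<zeta>(1)] D(1,2)[of x] n1 spos by (intro add_mono mult_mono) auto
    finally have "?C * \<bar>q - D x / \<alpha>\<bar> \<le> ?C * (\<delta> + \<bar>real n / s - 1 / \<alpha>\<bar>)"
      using C by (intro mult_left_mono) auto
    then show ?thesis using abs_ln_step_factor_diff_le[OF K(2) q d] D(3)[of x] by linarith
  qed
  have "?C * (\<epsilon> * K + \<delta> + \<bar>real n / s - 1 / \<alpha>\<bar>) = ?C * (\<epsilon> * K) + ?C * (\<delta> + \<bar>real n / s - 1 / \<alpha>\<bar>)"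
    by (simp add: algebra_simps)
  moreover have "real (Suc n) * \<Lambda> x = real n * \<Lambda> x + \<Lambda> x" by (simp add: algebra_simps)
  ultimately show ?thesis unfolding L' using 1 2 3 by linarith
qed

text \<open>Once the Courant condition holds, each step adds at most a fixed small
  \<open>\<eta>\<close> to the uniform error on [-K, K]. After n steps the error is a constant plus
  \<open>\<eta> * n\<close>, and division by n leaves little more than
  \<open>\<eta>\<close>.\<close>

proposition upwind_limit:
  fixes L v :: "nat \<Rightarrow> real \<Rightarrow> real" and s :: "nat \<Rightarrow> real" and \<Lambda> D :: "real \<Rightarrow> real"
  assumes \<alpha>: "1 < \<alpha>" and s: "\<And>n. real n \<le> s n" "(\<lambda>n. s n / real n) \<longlonglongrightarrow> \<alpha>"
    and L: "\<And>n x. (L n has_real_derivative v n x) (at x)" "\<And>n. L n 0 = 0"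
    and v: "\<And>n x. 0 \<le> v n x" "\<And>n x. v n x \<le> s n" "\<And>n x y. \<bar>v n x - v n y\<bar> \<le> s n * \<bar>x - y\<bar>"
    and L_Suc: "\<And>n x. L (Suc n) x = L n x + ln (step_factor x (v n x / s n))"
    and \<Lambda>: "\<And>x. (\<Lambda> has_real_derivative D x) (at x)" "\<Lambda> 0 = 0"
    and D: "\<And>x. 0 \<le> D x" "\<And>x. D x \<le> 1" "\<And>x. \<Lambda> x = ln (step_factor x (D x / \<alpha>))"
    and cont: "continuous_on UNIV D"
  shows "(\<lambda>n. L n x / real n) \<longlonglongrightarrow> \<Lambda> x"
proof (rule LIMSEQ_I)
  fix r :: real assume r: "0 < r"
  define K where "K = \<bar>x\<bar> + 1"
  have K: "0 < K" "\<bar>x\<bar> \<le> K" by (auto simp: K_def)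
  let ?C = "K * exp (2 * K)"
  define \<eta> where "\<eta> = r / 2"
  have C: "0 < ?C" and \<eta>: "0 < \<eta>" using K r by (auto simp: \<eta>_def)
  \<comment> \<open>One third of \<open>\<eta>\<close> for each of the three terms in the bracket of
    \<open>upwind_error\<close>.\<close>
  define \<delta> where "\<delta> = \<eta> / (3 * ?C)"
  have \<delta>: "0 < \<delta>" and C\<delta>: "?C * \<delta> = \<eta> / 3" using C \<eta> K by (simp_all add: \<delta>_def)
  \<comment> \<open>The interval is doubled because the mean value points are only known to lie
    within \<open>\<epsilon> * K \<le> K\<close> of a point of [-K, K].\<close>
  have "uniformly_continuous_on {- (2 * K) .. 2 * K} D"
    by (intro compact_uniformly_continuous continuous_on_subset[OF cont]) auto
  then obtain \<rho> where \<rho>: "0 < \<rho>"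
    "\<And>y z. y \<in> {- (2 * K) .. 2 * K} \<Longrightarrow> z \<in> {- (2 * K) .. 2 * K} \<Longrightarrow> \<bar>y - z\<bar> < \<rho> \<Longrightarrow> \<bar>D y - D z\<bar> < \<delta>"
    using \<delta> unfolding uniformly_continuous_on_def dist_real_def by metis
  define \<epsilon> where "\<epsilon> = min (1 / 2) (min \<delta> (\<rho> / 2) / K)"
  have \<epsilon>: "0 < \<epsilon>" "\<epsilon> < 1" using K \<delta> \<rho> by (auto simp: \<epsilon>_def)
  have "\<epsilon> * K \<le> min \<delta> (\<rho> / 2) / K * K" using K by (intro mult_right_mono) (auto simp: \<epsilon>_def)
  then have "\<epsilon> * K \<le> min \<delta> (\<rho> / 2)" using K by simp
  then have \<epsilon>K: "\<epsilon> * K \<le> \<delta>" "\<epsilon> * K < \<rho>" using \<rho> by auto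
  have \<epsilon>K': "\<epsilon> * K \<le> K" using \<epsilon> K by simp
  have uc: "\<bar>D z - D y\<bar> \<le> \<delta>" if "\<bar>y\<bar> \<le> K" "\<bar>z - y\<bar> \<le> \<epsilon> * K" for y z
  proof -
    have "\<bar>z\<bar> \<le> 2 * K" "\<bar>y\<bar> \<le> 2 * K" "\<bar>z - y\<bar> < \<rho>" using that \<epsilon>K \<epsilon>K' K by linarith+
    then show ?thesis by (intro less_imp_le \<rho>(2)) auto
  qed
  have "(\<lambda>n. real n / s n) \<longlonglongrightarrow> 1 / \<alpha>"
    using tendsto_divide[OF tendsto_const[of 1] s(2)] \<alpha> by simp
  then have "\<forall>\<^sub>F n in sequentially. \<bar>real n / s n - 1 / \<alpha>\<bar> < \<delta>"
    using \<delta> unfolding tendsto_iff dist_real_def by blast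
  moreover have "\<forall>\<^sub>F n in sequentially. exp (2 * K) / \<epsilon> \<le> real n" by real_asymp
  ultimately have "\<forall>\<^sub>F n in sequentially. \<bar>real n / s n - 1 / \<alpha>\<bar> < \<delta> \<and> exp (2 * K) / \<epsilon> \<le> real n \<and> 1 \<le> n"
    using eventually_ge_at_top[of "1::nat"] by eventually_elim auto
  then obtain N where N: "\<And>n. n \<ge> N \<Longrightarrow> \<bar>real n / s n - 1 / \<alpha>\<bar> < \<delta> \<and> exp (2 * K) / \<epsilon> \<le> real n \<and> 1 \<le> n"
    by (auto simp: eventually_sequentially)
  \<comment> \<open>The induction starts at \<open>N\<close>, where the Courant condition begins to
    hold. The discrepancy accumulated before is a single continuous function, hence bounded by some
    \<open>B\<close> on the compact interval.\<close>
  have "continuous_on {- K..K} (\<lambda>y. L N y - real N * \<Lambda> y)"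
    by (intro continuous_intros DERIV_continuous_on[OF DERIV_subset[OF L(1)]]
        DERIV_continuous_on[OF DERIV_subset[OF \<Lambda>(1)]]) auto
  then have "compact ((\<lambda>y. L N y - real N * \<Lambda> y) ` {- K..K})"
    by (rule compact_continuous_image) simp
  then obtain B where B: "\<And>y. y \<in> {- K..K} \<Longrightarrow> \<bar>L N y - real N * \<Lambda> y\<bar> \<le> B"
    using compact_imp_bounded[THEN bounded_iff[THEN iffD1]] by fastforce
  have ind: "\<forall>y. \<bar>y\<bar> \<le> K \<longrightarrow> \<bar>L n y - real n * \<Lambda> y\<bar> \<le> B + \<eta> * real (n - N)" if "n \<ge> N" for n
    using that
  proof (induction n rule: dec_induct)
    case base
    then show ?case using B by (simp add: abs_le_iff)
  next
    case (step n)
    show ?case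
    proof (intro allI impI)
      fix y assume y: "\<bar>y\<bar> \<le> K"
      have n: "\<bar>real n / s n - 1 / \<alpha>\<bar> < \<delta>" "exp (2 * K) / \<epsilon> \<le> real n" "1 \<le> n" using N step.hyps by auto
      have "exp (2 * K) / \<epsilon> \<le> s n" using n(2) s(1)[of n] by linarith
      then have s2: "exp (2 * K) \<le> s n * \<epsilon>" using \<epsilon> by (simp add: field_simps)
      have "\<bar>L (Suc n) y - real (Suc n) * \<Lambda> y\<bar> \<le> B + \<eta> * real (n - N)
          + ?C * (\<epsilon> * K + \<delta> + \<bar>real n / s n - 1 / \<alpha>\<bar>)"
        by (rule upwind_error[where L = "L n" and L' = "L (Suc n)" and v = "v n" and D = D,
              OF K(1) y \<epsilon> n(3) s(1) s2 \<alpha> L v L_Suc \<Lambda> D])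
          (use uc[OF y] step.IH in auto)
      also have "?C * (\<epsilon> * K + \<delta> + \<bar>real n / s n - 1 / \<alpha>\<bar>) \<le> ?C * (\<delta> + \<delta> + \<delta>)"
        using C \<epsilon>K n by (intro mult_left_mono) auto
      also have "?C * (\<delta> + \<delta> + \<delta>) = \<eta>" using C\<delta> by (simp add: algebra_simps)
      also have "B + \<eta> * real (n - N) + \<eta> = B + \<eta> * real (Suc n - N)"
        using step.hyps by (simp add: Suc_diff_le algebra_simps)
      finally show "\<bar>L (Suc n) y - real (Suc n) * \<Lambda> y\<bar> \<le> B + \<eta> * real (Suc n - N)" by simp
    qed
  qed
  have "\<forall>\<^sub>F n in sequentially. (\<bar>B\<bar> + 1) / \<eta> \<le> real n" by real_asymp
  then have "\<forall>\<^sub>F n in sequentially. \<bar>L n x / real n - \<Lambda> x\<bar> < r"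
    using eventually_ge_at_top[of N] eventually_ge_at_top[of 1]
  proof eventually_elim
    case (elim n)
    have "\<bar>B\<bar> + 1 \<le> \<eta> * real n" using elim(1) \<eta> by (simp add: field_simps)
    moreover have "\<eta> * real (n - N) \<le> \<eta> * real n" using \<eta> by (intro mult_left_mono) auto
    moreover have "\<bar>L n x - real n * \<Lambda> x\<bar> \<le> B + \<eta> * real (n - N)" using ind[OF elim(2)] K by blast
    ultimately have "\<bar>L n x - real n * \<Lambda> x\<bar> < 2 * \<eta> * real n" by linarith
    moreover have "L n x / real n - \<Lambda> x = (L n x - real n * \<Lambda> x) / real n"
      using elim(3) by (simp add: field_simps)
    ultimately show ?case using elim(3) by (simp add: \<eta>_def pos_divide_less_eq)
  qed
  then show "\<exists>no. \<forall>n\<ge>no. norm (L n x / real n - \<Lambda> x) < r"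
    by (simp add: eventually_sequentially)
qed

section \<open>The limiting pressure\<close>

definition recip_kernel :: "real \<Rightarrow> real \<Rightarrow> real" where
  "recip_kernel x u = 1 / (1 - u + u * exp x)"

text \<open>
  The expectation of \<open>1 / (1 - U + U e\<^sup>x)\<close> for \<open>U\<close> with density \<open>\<alpha> u\<^sup>\<alpha>\<^sup>-\<^sup>1\<close>; the substitution
  \<open>u = (e\<^sup>t - 1) / (e\<^sup>x - 1)\<close> turns it into \<open>exp (- \<Lambda> x)\<close>, without a singularity at \<open>x = 0\<close>.
\<close>

definition beta_transform :: "real \<Rightarrow> real \<Rightarrow> real" where
  "beta_transform \<alpha> x = integral {0..1} (\<lambda>u. \<alpha> * u powr (\<alpha> - 1) * recip_kernel x u)"

definition beta_transform_deriv :: "real \<Rightarrow> real \<Rightarrow> real" where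
  "beta_transform_deriv \<alpha> x =
    integral {0..1} (\<lambda>u. \<alpha> * u powr (\<alpha> - 1) * (- u * exp x * (recip_kernel x u)\<^sup>2))"

context
  fixes \<alpha> :: real
  assumes \<alpha>: "1 < \<alpha>"
begin

lemma denominator_pos:
  fixes u x :: real
  assumes "u \<in> {0..1}" shows "0 < 1 - u + u * exp x"
proof (cases "u = 1")
  case False
  then show ?thesis using assms by (intro add_pos_nonneg) auto
qed simp

lemma continuous_on_powr: "continuous_on A (\<lambda>z. f z powr (\<alpha> - 1))"
  if "continuous_on A f" "\<And>z. z \<in> A \<Longrightarrow> 0 \<le> f z" for f :: "'b::topological_space \<Rightarrow> real" and A
  using that \<alpha> by (intro continuous_on_powr' continuous_intros) auto

lemma continuous_on_recip_kernel [continuous_intros]: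
  assumes "continuous_on A f" "continuous_on A g" "\<And>z. z \<in> A \<Longrightarrow> g z \<in> {0..1}"
  shows "continuous_on A (\<lambda>z. recip_kernel (f z) (g z))"
proof -
  have "\<forall>z\<in>A. 1 - g z + g z * exp (f z) \<noteq> 0" using denominator_pos[OF assms(3)] by (metis less_irrefl)
  then show ?thesis unfolding recip_kernel_def by (intro continuous_intros assms)
qed

lemma continuous_integrand:
  "continuous_on {0..1} (\<lambda>u. \<alpha> * u powr (\<alpha> - 1) * recip_kernel x u)"
  by (intro continuous_intros continuous_on_powr) auto

lemma continuous_integrand_deriv:
  "continuous_on (UNIV \<times> {0..1}) (\<lambda>(x, u). \<alpha> * u powr (\<alpha> - 1) * (- u * exp x * (recip_kernel x u)\<^sup>2))"
  unfolding split_beta by (intro continuous_intros continuous_on_powr) auto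

lemma continuous_integrand_deriv':
  "continuous_on {0..1} (\<lambda>u. \<alpha> * u powr (\<alpha> - 1) * (- u * exp x * (recip_kernel x u)\<^sup>2))"
  by (intro continuous_intros continuous_on_powr) auto

lemma beta_transform_has_derivative:
  "(beta_transform \<alpha> has_real_derivative beta_transform_deriv \<alpha> x) (at x)"
proof -
  have "((\<lambda>x. integral (cbox 0 1) (\<lambda>u. \<alpha> * u powr (\<alpha> - 1) * recip_kernel x u)) has_field_derivative
    integral (cbox 0 1) (\<lambda>u. \<alpha> * u powr (\<alpha> - 1) * (- u * exp x * (recip_kernel x u)\<^sup>2))) (at x within UNIV)"
  proof (rule leibniz_rule_field_derivative)
    fix x u :: real assume u: "u \<in> cbox 0 1"
    show "((\<lambda>x. \<alpha> * u powr (\<alpha> - 1) * recip_kernel x u) has_field_derivative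
        \<alpha> * u powr (\<alpha> - 1) * (- u * exp x * (recip_kernel x u)\<^sup>2)) (at x within UNIV)"
      unfolding recip_kernel_def using denominator_pos[of u x] u
      by (auto intro!: derivative_eq_intros simp: power2_eq_square)
  next
    fix x :: real
    show "(\<lambda>u. \<alpha> * u powr (\<alpha> - 1) * recip_kernel x u) integrable_on cbox 0 1"
      using integrable_continuous_interval[OF continuous_integrand] by simp
  next
    show "continuous_on (UNIV \<times> cbox 0 1)
        (\<lambda>(x, u). \<alpha> * u powr (\<alpha> - 1) * (- u * exp x * (recip_kernel x u)\<^sup>2))"
      using continuous_integrand_deriv by simp
  qed auto
  then show ?thesis
    unfolding beta_transform_def[abs_def] beta_transform_deriv_def by simp
qed

lemma continuous_beta_transform_deriv: "continuous_on UNIV (beta_transform_deriv \<alpha>)"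
  unfolding beta_transform_deriv_def[abs_def]
  using integral_continuous_on_param[of UNIV 0 1 "\<lambda>x u. \<alpha> * u powr (\<alpha> - 1) * (- u * exp x * (recip_kernel x u)\<^sup>2)"]
    continuous_integrand_deriv by simp

lemma powr_has_integral: "((\<lambda>u. \<alpha> * u powr (\<alpha> - 1)) has_integral 1) {0..1}"
proof -
  have "((\<lambda>u. \<alpha> * u powr (\<alpha> - 1)) has_integral (1 powr \<alpha> - 0 powr \<alpha>)) {0..1}"
  proof (rule fundamental_theorem_of_calculus_interior)
    show "continuous_on {0..1} (\<lambda>u::real. u powr \<alpha>)"
      using \<alpha> by (intro continuous_on_powr' continuous_intros) auto
    show "((\<lambda>u::real. u powr \<alpha>) has_vector_derivative \<alpha> * u powr (\<alpha> - 1)) (at u)" if "u \<in> {0<..<1}" for u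
      unfolding has_real_derivative_iff_has_vector_derivative[symmetric]
      using that by (auto intro!: derivative_eq_intros)
  qed simp
  then show ?thesis using \<alpha> by simp
qed

lemma beta_transform_0: "beta_transform \<alpha> 0 = 1"
  using integral_unique[OF powr_has_integral] by (simp add: beta_transform_def recip_kernel_def)

text \<open>The kernel is at least \<open>exp (- \<bar>x\<bar>)\<close> and the density has mass 1.
  Positivity makes \<open>- ln (beta_transform \<alpha> x)\<close> meaningful and
  differentiable.\<close>

lemma beta_transform_pos: "0 < beta_transform \<alpha> x"
proof -
  define m where "m = exp (- \<bar>x\<bar>)"
  have m: "m * (\<alpha> * u powr (\<alpha> - 1)) \<le> \<alpha> * u powr (\<alpha> - 1) * recip_kernel x u" if u: "u \<in> {0..1}" for u
  proof -
    have "(1 - u) * 1 + u * exp x \<le> (1 - u) * exp \<bar>x\<bar> + u * exp \<bar>x\<bar>"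
      using u by (intro add_mono mult_left_mono) auto
    then have "1 - u + u * exp x \<le> exp \<bar>x\<bar>" by (simp add: algebra_simps)
    then have "m \<le> recip_kernel x u"
      using denominator_pos[OF u, of x] by (simp add: m_def recip_kernel_def exp_minus divide_simps)
    then show ?thesis using mult_left_mono[of m "recip_kernel x u" "\<alpha> * u powr (\<alpha> - 1)"] \<alpha>
      by (simp add: mult.commute)
  qed
  have i: "((\<lambda>u. m * (\<alpha> * u powr (\<alpha> - 1))) has_integral m * 1) {0..1}"
    by (intro has_integral_mult_right powr_has_integral)
  have "m * 1 \<le> beta_transform \<alpha> x"
    unfolding beta_transform_def
    by (rule has_integral_le[OF i integrable_integral[OF integrable_continuous_interval[OF continuous_integrand]] m])
  moreover have "0 < m" by (simp add: m_def)
  ultimately show ?thesis by linarith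
qed

text \<open>For \<open>\<Lambda> = - ln (beta_transform \<alpha> x)\<close> these inequalities say
  that the derivative of \<Lambda> lies in [0, 1], as the scheme requires. Pointwise, the second one
  is \<open>u * exp x \<le> 1 - u + u * exp x\<close>.\<close>

lemma beta_transform_deriv_bounds:
  "beta_transform_deriv \<alpha> x \<le> 0" "- beta_transform_deriv \<alpha> x \<le> beta_transform \<alpha> x"
proof -
  let ?k = "recip_kernel x"
  have k: "0 \<le> ?k u" "u * exp x * (?k u)\<^sup>2 \<le> ?k u" if u: "u \<in> {0..1}" for u
  proof -
    show k0: "0 \<le> ?k u" using denominator_pos[OF u, of x] by (simp add: recip_kernel_def)
    have "u * exp x * ?k u \<le> 1"
      using denominator_pos[OF u, of x] u by (simp add: recip_kernel_def)
    from mult_right_mono[OF this k0] show "u * exp x * (?k u)\<^sup>2 \<le> ?k u"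
      by (simp add: power2_eq_square mult.assoc)
  qed
  note int = integrable_continuous_interval[OF continuous_integrand_deriv', of x]
  have "beta_transform_deriv \<alpha> x \<le> integral {0..1} (\<lambda>u::real. 0)"
    unfolding beta_transform_deriv_def
    using \<alpha> by (intro integral_le int) (auto simp: mult_nonneg_nonneg)
  then show "beta_transform_deriv \<alpha> x \<le> 0" by simp
  show "- beta_transform_deriv \<alpha> x \<le> beta_transform \<alpha> x"
    unfolding beta_transform_deriv_def beta_transform_def integral_neg[symmetric]
  proof (intro integral_le integrable_neg int integrable_continuous_interval[OF continuous_integrand])
    fix u :: real assume u: "u \<in> {0..1}"
    have "\<alpha> * u powr (\<alpha> - 1) * (u * exp x * (?k u)\<^sup>2) \<le> \<alpha> * u powr (\<alpha> - 1) * ?k u"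
      using k(2)[OF u] \<alpha> by (intro mult_left_mono) auto
    then show "- (\<alpha> * u powr (\<alpha> - 1) * (- u * exp x * (?k u)\<^sup>2)) \<le> \<alpha> * u powr (\<alpha> - 1) * ?k u"
      by simp
  qed
qed

text \<open>Integration by parts, i.e. the fundamental theorem applied to \<open>u\<^sup>\<alpha> / (1 - u + u e\<^sup>x)\<close>.\<close>

lemma beta_transform_ode:
  "exp x * beta_transform \<alpha> x + (exp x - 1) * beta_transform_deriv \<alpha> x / \<alpha> = 1"
proof -
  let ?k = "recip_kernel x"
  let ?f = "\<lambda>u. \<alpha> * u powr (\<alpha> - 1) * ?k u" and ?g = "\<lambda>u. \<alpha> * u powr (\<alpha> - 1) * (- u * exp x * (?k u)\<^sup>2)"
  \<comment> \<open>The factor is chosen because \<open>(1 - exp (- x)) * exp x = exp x - 1\<close>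
    is what differentiating the kernel in \<open>u\<close> produces. The boundary value at
    \<open>u = 1\<close> is \<open>exp (- x)\<close>; multiplication by \<open>exp x\<close> at the
    end gives the stated form.\<close>
  have 1: "((\<lambda>u. ?f u + (1 - exp (- x)) / \<alpha> * ?g u) has_integral
      beta_transform \<alpha> x + (1 - exp (- x)) / \<alpha> * beta_transform_deriv \<alpha> x) {0..1}"
    unfolding beta_transform_def beta_transform_deriv_def
    by (intro has_integral_add has_integral_mult_right integrable_integral integrable_continuous_interval
        continuous_integrand continuous_integrand_deriv')
  have 2: "((\<lambda>u. ?f u + (1 - exp (- x)) / \<alpha> * ?g u) has_integral (1 powr \<alpha> * ?k 1 - 0 powr \<alpha> * ?k 0)) {0..1}"
  proof (rule fundamental_theorem_of_calculus_interior)
    show "continuous_on {0..1} (\<lambda>u. u powr \<alpha> * ?k u)"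
      using \<alpha> by (intro continuous_on_powr' continuous_intros) auto
    fix u :: real assume u: "u \<in> {0<..<1}"
    have pos: "0 < 1 - u + u * exp x" using u denominator_pos by simp
    have "(?k has_real_derivative - (exp x - 1) * (?k u)\<^sup>2) (at u)"
      unfolding recip_kernel_def using pos by (auto intro!: derivative_eq_intros simp: power2_eq_square)
    moreover have "((\<lambda>u. u powr \<alpha>) has_real_derivative \<alpha> * u powr (\<alpha> - 1)) (at u)"
      using u by (auto intro!: derivative_eq_intros)
    ultimately have "((\<lambda>u. u powr \<alpha> * ?k u) has_real_derivative
        \<alpha> * u powr (\<alpha> - 1) * ?k u + (- (exp x - 1) * (?k u)\<^sup>2) * u powr \<alpha>) (at u)"
      by (intro DERIV_mult)
    then have "((\<lambda>u. u powr \<alpha> * ?k u) has_real_derivative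
        \<alpha> * u powr (\<alpha> - 1) * ?k u + u powr \<alpha> * (- (exp x - 1) * (?k u)\<^sup>2)) (at u)"
      by (simp only: mult.commute)
    moreover have "u powr \<alpha> = u powr (\<alpha> - 1) * u" using u by (simp add: powr_diff)
    moreover have "(1 - exp (- x)) * exp x = exp x - 1" by (simp add: left_diff_distrib exp_minus)
    ultimately have "((\<lambda>u. u powr \<alpha> * ?k u) has_real_derivative ?f u + (1 - exp (- x)) / \<alpha> * ?g u) (at u)"
    proof -
      assume d: "((\<lambda>u. u powr \<alpha> * ?k u) has_real_derivative
        \<alpha> * u powr (\<alpha> - 1) * ?k u + u powr \<alpha> * (- (exp x - 1) * (?k u)\<^sup>2)) (at u)"
        and p: "u powr \<alpha> = u powr (\<alpha> - 1) * u" and e: "(1 - exp (- x)) * exp x = exp x - 1"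
      have "(1 - exp (- x)) / \<alpha> * ?g u = u powr (\<alpha> - 1) * u * (- ((1 - exp (- x)) * exp x) * (?k u)\<^sup>2)"
        using \<alpha> by simp
      then show ?thesis using d unfolding p e by simp
    qed
    then show "((\<lambda>u. u powr \<alpha> * ?k u) has_vector_derivative ?f u + (1 - exp (- x)) / \<alpha> * ?g u) (at u)"
      by (simp add: has_real_derivative_iff_has_vector_derivative)
  qed simp
  have "beta_transform \<alpha> x + (1 - exp (- x)) / \<alpha> * beta_transform_deriv \<alpha> x = exp (- x)"
    using has_integral_unique[OF 1 2] \<alpha> by (simp add: recip_kernel_def exp_minus inverse_eq_divide)
  moreover have inv: "exp x * exp (- x) = 1" by (simp add: exp_minus)
  moreover have "exp x * (beta_transform \<alpha> x + (1 - exp (- x)) / \<alpha> * beta_transform_deriv \<alpha> x)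
      = exp x * beta_transform \<alpha> x + (exp x - exp x * exp (- x)) * beta_transform_deriv \<alpha> x / \<alpha>"
    by (simp add: algebra_simps diff_divide_distrib)
  ultimately show ?thesis by simp
qed

text \<open>The power of \<open>r\<close> is an integrating factor: by
  \<open>beta_transform_ode\<close> the derivative of \<open>H\<close> is exactly
  \<open>r t powr (\<alpha> - 1)\<close>. Moreover \<open>r 0 = 0\<close> makes \<open>H 0\<close>
  vanish, and \<open>r \<theta> = 1\<close> leaves the transform itself in
  \<open>H \<theta>\<close>.\<close>

lemma beta_transform_eq_interval_integral:
  assumes \<theta>: "\<theta> \<noteq> 0"
  shows "beta_transform \<alpha> \<theta> = \<alpha> / (exp \<theta> - 1) *
    (LBINT t=0..ereal \<theta>. ((exp t - 1) / (exp \<theta> - 1)) powr (\<alpha> - 1))"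
proof -
  define r where "r t = (exp t - 1) / (exp \<theta> - 1)" for t
  define H where "H t = (exp \<theta> - 1) / \<alpha> * (r t powr \<alpha> * beta_transform \<alpha> t)" for t
  \<comment> \<open>Ordered endpoints treat both signs of \<theta> together, since \<open>r\<close>
    is nonnegative between 0 and \<theta> in either case; the orientation is restored at the
    end.\<close>
  define a b where "a = min 0 \<theta>" and "b = max 0 \<theta>"
  have r0: "0 \<le> r t" if "t \<in> {a..b}" for t
    using that \<theta> unfolding r_def a_def b_def
    by (cases "\<theta> > 0") (auto intro: divide_nonpos_nonpos)
  have rpos: "0 < r t" if "t \<in> {a<..<b}" for t
    using that \<theta> unfolding r_def a_def b_def
    by (cases "\<theta> > 0") (auto intro: divide_neg_neg)
  have e1: "exp \<theta> - 1 \<noteq> 0" using \<theta> by simp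
  have cr: "continuous_on A r" for A unfolding r_def using e1 by (intro continuous_intros) auto
  have cF: "continuous_on A (beta_transform \<alpha>)" for A
    using beta_transform_has_derivative by (meson DERIV_continuous_on has_field_derivative_at_within)
  have cont: "continuous_on {a..b} (\<lambda>t. r t powr (\<alpha> - 1))"
    using r0 by (intro continuous_on_powr cr) auto
  have hi: "((\<lambda>t. r t powr (\<alpha> - 1)) has_integral (H b - H a)) {a..b}"
  proof (rule fundamental_theorem_of_calculus_interior)
    show "continuous_on {a..b} H" unfolding H_def
      using r0 \<alpha> by (intro continuous_intros continuous_on_powr' cr cF) auto
    fix t assume t: "t \<in> {a<..<b}"
    have r': "(r has_real_derivative exp t / (exp \<theta> - 1)) (at t)"
      unfolding r_def using e1 by (auto intro!: derivative_eq_intros)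
    have p: "r t powr \<alpha> = r t powr (\<alpha> - 1) * r t" using rpos[OF t] by (simp add: powr_diff)
    have "(H has_real_derivative (exp \<theta> - 1) / \<alpha> *
        (\<alpha> * r t powr (\<alpha> - 1) * (exp t / (exp \<theta> - 1)) * beta_transform \<alpha> t
          + beta_transform_deriv \<alpha> t * r t powr \<alpha>)) (at t)"
      unfolding H_def using rpos[OF t]
      by (intro DERIV_cmult DERIV_mult beta_transform_has_derivative)
        (rule DERIV_cong[OF DERIV_fun_powr[OF r']], auto)
    also have "(exp \<theta> - 1) / \<alpha> * (\<alpha> * r t powr (\<alpha> - 1) * (exp t / (exp \<theta> - 1)) * beta_transform \<alpha> t
          + beta_transform_deriv \<alpha> t * r t powr \<alpha>)
        = r t powr (\<alpha> - 1) * (exp t * beta_transform \<alpha> t + ((exp \<theta> - 1) * r t) * beta_transform_deriv \<alpha> t / \<alpha>)"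
      unfolding p using e1 \<alpha> by (simp add: field_simps)
    also have "(exp \<theta> - 1) * r t = exp t - 1" using e1 by (simp add: r_def)
    finally have "(H has_real_derivative r t powr (\<alpha> - 1)) (at t)"
      using beta_transform_ode[of t] by simp
    then show "(H has_vector_derivative r t powr (\<alpha> - 1)) (at t)"
      by (simp add: has_real_derivative_iff_has_vector_derivative)
  qed (simp add: a_def b_def)
  have ab: "a \<le> b" by (simp add: a_def b_def)
  have "(LBINT t=ereal a..ereal b. r t powr (\<alpha> - 1)) = H b - H a"
    using interval_integral_eq_integral[OF ab borel_integrable_atLeastAtMost'[OF cont]] integral_unique[OF hi]
    by simp
  then have "(LBINT t=0..ereal \<theta>. r t powr (\<alpha> - 1)) = H \<theta> - H 0"
    using \<theta> interval_integral_endpoints_reverse[of 0 "ereal \<theta>" "\<lambda>t. r t powr (\<alpha> - 1)"]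
    by (cases "\<theta> > 0") (auto simp: a_def b_def zero_ereal_def)
  then show ?thesis using e1 \<alpha> by (simp add: H_def r_def)
qed

end

section \<open>Ultra-log-concavity of the one-dimensional laws\<close>

text \<open>Totally positive of order 2, i.e. log-concave without internal zeros.\<close>

definition pf2 :: "(nat \<Rightarrow> real) \<Rightarrow> bool" where
  "pf2 q \<longleftrightarrow> (\<forall>i j. i \<le> j \<longrightarrow> q i * q (Suc j) \<le> q (Suc i) * q j)"

text \<open>
  In shifted indices the differences of the two sides pair off into \<open>2 \<times> 2\<close> minors of \<open>q\<close>, because
  \<open>k \<mapsto> c - k\<close> is concave.
\<close>

lemma pf2_triangle_step:
  fixes q :: "nat \<Rightarrow> real" and c :: real
  assumes q: "pf2 q" "\<And>k. 0 \<le> q k" and supp: "\<And>k. c < real k \<Longrightarrow> q k = 0"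
  shows "pf2 (\<lambda>k. (c - real k) * q k + q (Suc k))"
proof -
  define r where "r k = (c - real k) * q k + q (Suc k)" for k
  have cq: "0 \<le> (c - real k) * q k" for k
    using q(2)[of k] supp[of k] by (cases "c < real k") auto
  have r0: "0 \<le> r k" for k unfolding r_def using cq[of k] q(2)[of "Suc k"] by simp
  have "r a * r (Suc b) \<le> r (Suc a) * r b" if ab: "a \<le> b" for a b
  proof (cases "a = b")
    case False
    then have ab': "Suc a \<le> b" using ab by simp
    show ?thesis
    \<comment> \<open>Beyond the support both summands of \<open>r (Suc b)\<close> vanish. Otherwise
      \<open>B \<ge> 1\<close>, so all coefficients in the expansion below are nonnegative.\<close>
    proof (cases "c < real (Suc b)")
      case True
      then have "r (Suc b) = 0" by (simp add: r_def supp)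
      then show ?thesis using r0[of "Suc a"] r0[of b] by simp
    next
      case c: False
      define A B where "A = c - real a" and "B = c - real b"
      have B: "1 \<le> B" "B \<le> A" using c ab by (auto simp: A_def B_def)
      define x0 x1 x2 y0 y1 y2 where "x0 = q a" and "x1 = q (Suc a)" and "x2 = q (Suc (Suc a))"
        and "y0 = q b" and "y1 = q (Suc b)" and "y2 = q (Suc (Suc b))"
      have m: "x0 * y1 \<le> x1 * y0" "x0 * y2 \<le> x1 * y1" "x1 * y2 \<le> x2 * y1" "x1 * y1 \<le> x2 * y0"
        using q(1) ab ab' unfolding pf2_def x0_def x1_def x2_def y0_def y1_def y2_def by auto
      \<comment> \<open>Concavity of \<open>c - k\<close> enters as
        \<open>A * (B - 1) \<le> (A - 1) * B\<close>, which is just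
        \<open>B \<le> A\<close>.\<close>
      have xy: "0 \<le> x0 * y1" using q(2) by (simp add: x0_def y1_def)
      have "A * (B - 1) * (x0 * y1) \<le> (A - 1) * B * (x0 * y1)"
        using B xy by (intro mult_right_mono) (auto simp: algebra_simps)
      also have "\<dots> \<le> (A - 1) * B * (x1 * y0)"
        using B m by (intro mult_left_mono) auto
      finally have 1: "A * (B - 1) * (x0 * y1) \<le> (A - 1) * B * (x1 * y0)" .
      \<comment> \<open>The right side offers only \<open>A - 1\<close> copies of
        \<open>x1 * y1\<close>, one too few for this bound. The missing copy comes from the next
        one, which bounds \<open>B\<close> copies although the left side contains
        \<open>B - 1\<close>.\<close>
      have 2: "A * (x0 * y2) \<le> A * (x1 * y1)" using B m by (intro mult_left_mono) auto
      have 3: "B * (x1 * y1) \<le> B * (x2 * y0)" using B m by (intro mult_left_mono) auto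
      have "(A * x0 + x1) * ((B - 1) * y1 + y2)
          = A * (B - 1) * (x0 * y1) + A * (x0 * y2) + (B - 1) * (x1 * y1) + x1 * y2"
        by (simp add: algebra_simps)
      also have "\<dots> \<le> (A - 1) * B * (x1 * y0) + A * (x1 * y1) + (B * (x2 * y0) - x1 * y1) + x2 * y1"
        using 1 2 3 m(3) by (simp add: left_diff_distrib)
      also have "\<dots> = ((A - 1) * x1 + x2) * (B * y0 + y1)" by (simp add: algebra_simps)
      finally show ?thesis
        unfolding r_def x0_def x1_def x2_def y0_def y1_def y2_def A_def B_def
        by (simp add: algebra_simps)
    qed
  qed (simp add: mult.commute)
  then show ?thesis unfolding pf2_def r_def by blast
qed

text \<open>Chebyshev's symmetrization: the double sum is unchanged when \<open>i\<close> and
  \<open>j\<close> are exchanged, so only the symmetric part needs a sign.\<close>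

lemma sum_symmetrize_nonneg:
  fixes f :: "'b \<Rightarrow> 'b \<Rightarrow> real"
  assumes "\<And>i j. i \<in> A \<Longrightarrow> j \<in> A \<Longrightarrow> 0 \<le> f i j + f j i"
  shows "0 \<le> (\<Sum>i\<in>A. \<Sum>j\<in>A. f i j)"
proof -
  have "2 * (\<Sum>i\<in>A. \<Sum>j\<in>A. f i j) = (\<Sum>i\<in>A. \<Sum>j\<in>A. f i j) + (\<Sum>i\<in>A. \<Sum>j\<in>A. f j i)"
    using sum.swap[of "\<lambda>i j. f i j" A A] by simp
  also have "\<dots> = (\<Sum>i\<in>A. \<Sum>j\<in>A. f i j + f j i)" by (simp add: sum.distrib)
  also have "0 \<le> \<dots>" using assms by (intro sum_nonneg) auto
  finally show ?thesis by simp
qed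

lemma sum_cauchy_schwarz:
  fixes a :: "nat \<Rightarrow> real"
  assumes "\<And>k. 0 \<le> a k"
  shows "(\<Sum>k\<in>A. real k * a k)\<^sup>2 \<le> (\<Sum>k\<in>A. (real k)\<^sup>2 * a k) * (\<Sum>k\<in>A. a k)"
proof -
  have "0 \<le> (\<Sum>i\<in>A. \<Sum>j\<in>A. ((real i)\<^sup>2 - real i * real j) * (a i * a j))"
  proof (rule sum_symmetrize_nonneg)
    fix i j
    have "((real i)\<^sup>2 - real i * real j) * (a i * a j) + ((real j)\<^sup>2 - real j * real i) * (a j * a i)
      = (real i - real j)\<^sup>2 * (a i * a j)" by (simp add: power2_eq_square algebra_simps)
    also have "0 \<le> \<dots>" using assms by simp
    finally show "0 \<le> ((real i)\<^sup>2 - real i * real j) * (a i * a j) + ((real j)\<^sup>2 - real j * real i) * (a j * a i)" .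
  qed
  also have "\<dots> = (\<Sum>i\<in>A. \<Sum>j\<in>A. (real i)\<^sup>2 * a i * a j) - (\<Sum>i\<in>A. \<Sum>j\<in>A. real i * a i * (real j * a j))"
    by (simp add: sum_subtractf[symmetric] algebra_simps)
  also have "\<dots> = (\<Sum>k\<in>A. (real k)\<^sup>2 * a k) * (\<Sum>k\<in>A. a k) - (\<Sum>k\<in>A. real k * a k)\<^sup>2"
    by (simp add: sum_product power2_eq_square)
  finally show ?thesis by simp
qed

text \<open>
  The ratio \<open>(k + 1) a\<^sub>k\<^sub>+\<^sub>1 / a\<^sub>k\<close> is decreasing, hence negatively correlated with \<open>k\<close>.
\<close>

lemma variance_le_mean:
  fixes a :: "nat \<Rightarrow> real"
  assumes a: "pf2 (\<lambda>k. fact k * a k)" "\<And>k. 0 \<le> a k" and supp: "\<And>k. N < k \<Longrightarrow> a k = 0"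
  shows "(\<Sum>k\<le>N. (real k)\<^sup>2 * a k) * (\<Sum>k\<le>N. a k)
    \<le> (\<Sum>k\<le>N. real k * a k) * (\<Sum>k\<le>N. a k) + (\<Sum>k\<le>N. real k * a k)\<^sup>2"
proof -
  define b where "b k = real (Suc k) * a (Suc k)" for k
  have shift: "(\<Sum>k\<le>N. h k * (real k * a k)) = (\<Sum>k\<le>N. h (Suc k) * b k)" for h :: "nat \<Rightarrow> real"
  proof -
    \<comment> \<open>The added last term is zero by \<open>supp\<close>, and the first term is zero
      because of the factor \<open>k\<close>; so the index shift loses nothing.\<close>
    have "(\<Sum>k\<le>N. h k * (real k * a k)) = (\<Sum>k\<le>Suc N. h k * (real k * a k))"
      using supp by simp
    also have "\<dots> = (\<Sum>k\<le>N. h (Suc k) * b k)" unfolding sum.atMost_Suc_shift by (simp add: b_def)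
    finally show ?thesis .
  qed
  have dec: "b k * a j \<le> b j * a k" if "j \<le> k" for j k
  proof -
    have "(fact j * a j) * (fact (Suc k) * a (Suc k)) \<le> (fact (Suc j) * a (Suc j)) * (fact k * a k)"
      using a(1) that unfolding pf2_def by blast
    then have "(fact j * fact k) * (b k * a j) \<le> (fact j * fact k) * (b j * a k)"
      by (simp add: b_def fact_Suc algebra_simps del: of_nat_Suc)
    then show ?thesis by simp
  qed
  \<comment> \<open>By \<open>dec\<close> the ratio of \<open>b\<close> to \<open>a\<close>
    decreases, so after symmetrization both factors have the same sign. Expanding the sum gives the
    claim, once the moments of \<open>b\<close> are expressed by those of \<open>a\<close>.\<close>
  have "0 \<le> (\<Sum>k\<le>N. \<Sum>j\<le>N. (real j - real k) * (b k * a j))"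
  proof (rule sum_symmetrize_nonneg)
    fix k j
    have "(real j - real k) * (b k * a j) + (real k - real j) * (b j * a k)
      = (real k - real j) * (b j * a k - b k * a j)" by (simp add: algebra_simps)
    also have "0 \<le> \<dots>"
      using dec[of j k] dec[of k j] by (cases "j \<le> k") (auto intro: mult_nonneg_nonneg mult_nonpos_nonpos)
    finally show "0 \<le> (real j - real k) * (b k * a j) + (real k - real j) * (b j * a k)" .
  qed
  also have "\<dots> = (\<Sum>k\<le>N. b k) * (\<Sum>j\<le>N. real j * a j) - (\<Sum>k\<le>N. real k * b k) * (\<Sum>j\<le>N. a j)"
    unfolding sum_product sum_subtractf[symmetric]
    by (intro sum.cong refl) (simp add: algebra_simps)
  also have "(\<Sum>k\<le>N. b k) = (\<Sum>k\<le>N. real k * a k)" using shift[of "\<lambda>_. 1"] by simp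
  also have "(\<Sum>k\<le>N. real k * b k) = (\<Sum>k\<le>N. (real k)\<^sup>2 * a k) - (\<Sum>k\<le>N. real k * a k)"
    using shift[of "\<lambda>k. real k - 1"] by (simp add: power2_eq_square left_diff_distrib sum_subtractf mult.assoc)
  finally show ?thesis by (simp add: power2_eq_square algebra_simps)
qed

text \<open>\<open>weight s k0 n\<close> is the law of \<open>Z\<^sub>n\<^sub>+\<^sub>1\<close>, with \<open>s n\<close> standing for \<open>s\<^sub>n\<^sub>+\<^sub>1\<close>: time is shifted to start at 0.\<close>

primrec weight :: "(nat \<Rightarrow> real) \<Rightarrow> nat \<Rightarrow> nat \<Rightarrow> nat \<Rightarrow> real" where
  "weight s k0 0 = (\<lambda>k. if k = k0 then 1 else 0)"
| "weight s k0 (Suc n) = (\<lambda>k. case k of 0 \<Rightarrow> 0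
     | Suc j \<Rightarrow> (1 - real j / s n) * weight s k0 n j + real (Suc j) / s n * weight s k0 n (Suc j))"

lemma weight_support: "k0 + n < k \<Longrightarrow> weight s k0 n k = 0"
  by (induction n arbitrary: k) (auto split: nat.split)

text \<open>The \<open>m\<close>-th derivative in \<open>x\<close> of the moment generating
  function. For \<open>m = 0\<close> the term \<open>k = 0\<close> counts fully, since
  \<open>0 ^ 0 = 1\<close>.\<close>

definition exp_moment :: "(nat \<Rightarrow> real) \<Rightarrow> nat \<Rightarrow> nat \<Rightarrow> nat \<Rightarrow> real \<Rightarrow> real" where
  "exp_moment s k0 m n x = (\<Sum>k\<le>k0 + n. real k ^ m * (weight s k0 n k * exp (real k * x)))"

definition tilted_mean :: "(nat \<Rightarrow> real) \<Rightarrow> nat \<Rightarrow> nat \<Rightarrow> real \<Rightarrow> real" where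
  "tilted_mean s k0 n x = exp_moment s k0 1 n x / exp_moment s k0 0 n x"

context
  fixes s :: "nat \<Rightarrow> real" and k0 :: nat
  assumes s_pos: "\<And>n. 0 < s n" and s_ge: "\<And>n. real (k0 + n) \<le> s n"
begin

abbreviation "w \<equiv> weight s k0"
abbreviation "E \<equiv> exp_moment s k0"
abbreviation "V \<equiv> tilted_mean s k0"

lemma weight_nonneg: "0 \<le> w n k"
proof (induction n arbitrary: k)
  case (Suc n)
  have "0 \<le> (1 - real j / s n) * w n j" for j
  proof (cases "j \<le> k0 + n")
    case True
    then have "real j \<le> s n" using s_ge[of n] by linarith
    then show ?thesis using s_pos[of n] Suc by (intro mult_nonneg_nonneg) auto
  qed (simp add: weight_support)
  moreover have "0 \<le> real (Suc j) / s n * w n (Suc j)" for j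
    using s_pos[of n] Suc by (intro mult_nonneg_nonneg divide_nonneg_pos) auto
  ultimately show ?case by (auto split: nat.split)
qed simp

text \<open>The factorial absorbs the factor \<open>Suc j\<close> of the staying probability: in
  terms of \<open>q k = fact k * w n k\<close>, one step is the map of
  \<open>pf2_triangle_step\<close>, followed by a shift and by multiplication with
  \<open>k / s n\<close>, a log-concave sequence in \<open>k\<close>.\<close>

lemma pf2_weight: "pf2 (\<lambda>k. fact k * w n k)"
proof (induction n)
  case 0
  then show ?case by (auto simp: pf2_def)
next
  case (Suc n)
  define q where "q k = fact k * w n k" for k
  define r where "r k = (s n - real k) * q k + q (Suc k)" for k
  have "pf2 r" unfolding r_def
  proof (rule pf2_triangle_step)
    show "pf2 q" using Suc by (simp add: q_def[abs_def])
    show "0 \<le> q k" for k using weight_nonneg by (simp add: q_def)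
    show "q k = 0" if "s n < real k" for k
    proof -
      have "k0 + n < k" using that s_ge[of n] by linarith
      then show ?thesis by (simp add: q_def weight_support)
    qed
  qed
  have step: "fact (Suc k) * w (Suc n) (Suc k) = real (Suc k) / s n * r k" for k
    using s_pos[of n] by (simp add: r_def q_def fact_Suc field_simps del: of_nat_Suc)
  have r0: "0 \<le> r k" for k
  proof -
    have "0 \<le> fact (Suc k) * w (Suc n) (Suc k)" by (intro mult_nonneg_nonneg weight_nonneg) simp
    then have "0 \<le> real (Suc k) / s n * r k" unfolding step .
    then show ?thesis using s_pos[of n] by (simp add: zero_le_mult_iff zero_le_divide_iff)
  qed
  show ?case unfolding pf2_def
  proof (intro allI impI)
    fix i j :: nat assume ij: "i \<le> j"
    show "fact i * w (Suc n) i * (fact (Suc j) * w (Suc n) (Suc j))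
      \<le> fact (Suc i) * w (Suc n) (Suc i) * (fact j * w (Suc n) j)"
    proof (cases i)
      \<comment> \<open>From state 0 the chain moves up with probability 1, so
        \<open>w (Suc n) 0 = 0\<close> and the left side vanishes.\<close>
      case 0
      have "0 \<le> fact (Suc i) * w (Suc n) (Suc i) * (fact j * w (Suc n) j)"
        by (intro mult_nonneg_nonneg weight_nonneg) simp_all
      then show ?thesis using 0 by simp
    next
      case (Suc a)
      then obtain b where b: "j = Suc b" using ij by (cases j) auto
      have ab: "a \<le> b" using ij Suc b by simp
      have "real (Suc a) * real (Suc (Suc b)) * (r a * r (Suc b))
        \<le> real (Suc (Suc a)) * real (Suc b) * (r (Suc a) * r b)"
      proof (rule mult_mono)
        \<comment> \<open>Log-concavity of the factor \<open>k\<close>; after expansion this is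
          \<open>a \<le> b\<close>.\<close>
        show "real (Suc a) * real (Suc (Suc b)) \<le> real (Suc (Suc a)) * real (Suc b)"
          using ab by (simp add: algebra_simps)
        show "r a * r (Suc b) \<le> r (Suc a) * r b" using \<open>pf2 r\<close> ab by (simp add: pf2_def)
        show "0 \<le> r a * r (Suc b)" using r0 by simp
      qed simp
      then have "real (Suc a) * real (Suc (Suc b)) * (r a * r (Suc b)) / (s n * s n)
        \<le> real (Suc (Suc a)) * real (Suc b) * (r (Suc a) * r b) / (s n * s n)"
        using s_pos[of n] by (intro divide_right_mono) auto
      then show ?thesis unfolding Suc b step by (simp add: mult_ac del: of_nat_Suc)
    qed
  qed
qed

lemma exp_moment_Suc: "E 0 (Suc n) x = exp x * E 0 n x - (exp x - 1) / s n * E 1 n x"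
proof -
  let ?e = "\<lambda>k. exp (real k * x)"
  let ?N = "k0 + n"
  have "E 0 (Suc n) x = (\<Sum>k\<le>?N. w (Suc n) (Suc k) * ?e (Suc k))"
    unfolding exp_moment_def by (simp add: sum.atMost_Suc_shift del: sum.atMost_Suc)
  also have "\<dots> = (\<Sum>k\<le>?N. (1 - real k / s n) * w n k * ?e (Suc k)) + (\<Sum>k\<le>?N. real (Suc k) / s n * w n (Suc k) * ?e (Suc k))"
    by (simp add: sum.distrib[symmetric] distrib_right del: of_nat_Suc)
  also have "(\<Sum>k\<le>?N. real (Suc k) / s n * w n (Suc k) * ?e (Suc k)) = (\<Sum>k\<le>Suc ?N. real k / s n * w n k * ?e k)"
    by (simp add: sum.atMost_Suc_shift del: sum.atMost_Suc of_nat_Suc)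
  also have "\<dots> = (\<Sum>k\<le>?N. real k / s n * w n k * ?e k)" by (simp add: weight_support)
  also have "(\<Sum>k\<le>?N. (1 - real k / s n) * w n k * ?e (Suc k)) + (\<Sum>k\<le>?N. real k / s n * w n k * ?e k)
    = (\<Sum>k\<le>?N. exp x * (w n k * ?e k) - (exp x - 1) / s n * (real k * (w n k * ?e k)))"
    unfolding sum.distrib[symmetric]
    by (intro sum.cong refl) (simp add: exp_add algebra_simps diff_divide_distrib)
  also have "\<dots> = exp x * E 0 n x - (exp x - 1) / s n * E 1 n x"
    by (simp add: exp_moment_def sum_subtractf sum_distrib_left)
  finally show ?thesis .
qed

lemma exp_moment_deriv: "(E m n has_real_derivative E (Suc m) n x) (at x)"
  unfolding exp_moment_def[abs_def]
  by (auto intro!: derivative_eq_intros sum.cong simp: algebra_simps)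

lemma exp_moment_nonneg: "0 \<le> E m n x"
  unfolding exp_moment_def using weight_nonneg by (intro sum_nonneg) auto

lemma exp_moment_1_le: "E 1 n x \<le> real (k0 + n) * E 0 n x"
  unfolding exp_moment_def sum_distrib_left
  using weight_nonneg by (intro sum_mono) (auto intro!: mult_right_mono)

text \<open>After division by the square of \<open>E 0 n x\<close> these say that the variance of
  the tilted law lies between 0 and its mean. Tilting preserves \<open>pf2\<close> because the
  indices on both sides add up to \<open>i + j + 1\<close>.\<close>

lemma exp_moment_2_bounds:
  "(E 1 n x)\<^sup>2 \<le> E 2 n x * E 0 n x"
  "E 2 n x * E 0 n x \<le> E 1 n x * E 0 n x + (E 1 n x)\<^sup>2"
proof -
  let ?a = "\<lambda>k. w n k * exp (real k * x)"
  have a0: "0 \<le> ?a k" for k using weight_nonneg by simp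
  show "(E 1 n x)\<^sup>2 \<le> E 2 n x * E 0 n x"
    using sum_cauchy_schwarz[of ?a "{..k0 + n}"] a0 by (simp add: exp_moment_def)
  have "pf2 (\<lambda>k. fact k * ?a k)" unfolding pf2_def
  proof (intro allI impI)
    fix i j :: nat assume "i \<le> j"
    then have "fact i * w n i * (fact (Suc j) * w n (Suc j)) * exp (real (i + Suc j) * x)
      \<le> fact (Suc i) * w n (Suc i) * (fact j * w n j) * exp (real (i + Suc j) * x)"
      using pf2_weight[of n] unfolding pf2_def by (intro mult_right_mono) auto
    moreover have "exp (real (i + Suc j) * x) = exp (real i * x) * exp (real (Suc j) * x)"
      "exp (real (i + Suc j) * x) = exp (real (Suc i) * x) * exp (real j * x)"
      by (simp_all add: exp_add[symmetric] algebra_simps)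
    ultimately show "fact i * ?a i * (fact (Suc j) * ?a (Suc j)) \<le> fact (Suc i) * ?a (Suc i) * (fact j * ?a j)"
      by (metis (no_types, lifting) mult.assoc mult.left_commute)
  qed
  from variance_le_mean[OF this a0, of "k0 + n"]
  show "E 2 n x * E 0 n x \<le> E 1 n x * E 0 n x + (E 1 n x)\<^sup>2"
    by (simp add: exp_moment_def weight_support)
qed

text \<open>Each step of the recursion multiplies by the convex combination
  \<open>(1 - p) * exp x + p\<close>, where \<open>p \<le> 1\<close> because the support of
  \<open>w n\<close> lies below \<open>s n\<close>.\<close>

lemma exp_moment_0_pos: "0 < E 0 n x"
proof (induction n arbitrary: x)
  case 0
  have "E 0 0 x = exp (real k0 * x)" unfolding exp_moment_def
    by (simp add: if_distrib[of "\<lambda>z. z * _"] sum.delta cong: if_cong)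
  then show ?case by simp
next
  case (Suc n)
  define p where "p = E 1 n x / E 0 n x / s n"
  have p0: "0 \<le> p" unfolding p_def using exp_moment_nonneg s_pos[of n] by (simp add: less_imp_le)
  have "E 1 n x \<le> s n * E 0 n x"
    using exp_moment_1_le[of n x] mult_right_mono[OF s_ge[of n] less_imp_le[OF Suc[of x]]] by linarith
  then have p1: "p \<le> 1" unfolding p_def using Suc[of x] s_pos[of n] by (simp add: field_simps)
  have "E 0 n x * p = E 1 n x / s n" using Suc[of x] by (simp add: p_def)
  then have "E 0 (Suc n) x = E 0 n x * exp x - (exp x - 1) * (E 0 n x * p)"
    by (simp add: exp_moment_Suc)
  then have "E 0 (Suc n) x = E 0 n x * ((1 - p) * exp x + p)" by (simp add: algebra_simps)
  moreover have "0 < (1 - p) * exp x + p"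
    using p0 p1 by (cases "p = 1") (auto intro!: add_pos_nonneg)
  ultimately show ?case using Suc[of x] by simp
qed

lemma ln_exp_moment_deriv: "((\<lambda>x. ln (E 0 n x)) has_real_derivative V n x) (at x)"
  unfolding tilted_mean_def using exp_moment_0_pos[of n x]
  by (auto intro!: derivative_eq_intros exp_moment_deriv[of 0, simplified])

lemma tilted_mean_bounds: "0 \<le> V n x" "V n x \<le> real (k0 + n)" "V n x \<le> s n"
proof -
  show "0 \<le> V n x" unfolding tilted_mean_def using exp_moment_nonneg by simp
  show "V n x \<le> real (k0 + n)"
    unfolding tilted_mean_def using exp_moment_1_le[of n x] exp_moment_0_pos[of n x] by (simp add: field_simps)
  then show "V n x \<le> s n" using s_ge[of n] by linarith
qed

text \<open>The derivative of the tilted mean is the tilted variance, at most the tilted mean, hence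
  at most \<open>s n\<close>. This is the place where ultra-log-concavity is turned into the linear
  growth that the scheme needs.\<close>

lemma tilted_mean_lipschitz: "\<bar>V n x - V n y\<bar> \<le> s n * \<bar>x - y\<bar>"
proof -
  define d where "d x = (E 2 n x * E 0 n x - E 1 n x * E 1 n x) / (E 0 n x * E 0 n x)" for x
  have d': "(V n has_real_derivative d x) (at x)" for x
    unfolding tilted_mean_def[abs_def] d_def using exp_moment_0_pos[of n x]
    by (intro DERIV_divide exp_moment_deriv[of 0, simplified] exp_moment_deriv[of 1, simplified])
      (auto simp: numeral_2_eq_2 intro: exp_moment_deriv)
  have db: "norm (d x) \<le> s n" for x
  proof -
    have "0 \<le> d x" unfolding d_def using exp_moment_2_bounds(1)[of n x]
      by (intro divide_nonneg_nonneg) (auto simp: power2_eq_square)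
    moreover have "d x \<le> (E 1 n x * E 0 n x) / (E 0 n x * E 0 n x)"
      unfolding d_def using exp_moment_2_bounds(2)[of n x]
      by (intro divide_right_mono) (auto simp: power2_eq_square)
    moreover have "\<dots> = V n x" using exp_moment_0_pos[of n x] by (simp add: tilted_mean_def)
    ultimately show ?thesis using tilted_mean_bounds(3)[of n x] by simp
  qed
  show ?thesis
    using field_differentiable_bound[of UNIV "V n" d "s n" x y] d' db by simp
qed

lemma ln_exp_moment_0: "ln (E 0 n 0) = 0"
proof -
  have "E 0 n 0 = 1"
  proof (induction n)
    case 0
    show ?case unfolding exp_moment_def by simp
  next
    case (Suc n)
    then show ?case by (simp add: exp_moment_Suc)
  qed
  then show ?thesis by simp
qed

lemma ln_exp_moment_Suc:
  "ln (E 0 (Suc n) x) = ln (E 0 n x) + ln (exp x - (exp x - 1) * (V n x / s n))"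
proof -
  have eq: "E 0 (Suc n) x = E 0 n x * (exp x - (exp x - 1) * (V n x / s n))"
    unfolding exp_moment_Suc tilted_mean_def using exp_moment_0_pos[of n x] by (simp add: right_diff_distrib)
  have "0 < exp x - (exp x - 1) * (V n x / s n)"
    using exp_moment_0_pos[of "Suc n" x] exp_moment_0_pos[of n x] unfolding eq by (simp add: zero_less_mult_iff)
  then show ?thesis unfolding eq using exp_moment_0_pos[of n x] by (simp add: ln_mult)
qed

end

section \<open>The Gaertner-Ellis theorem on the line\<close>

lemma ln_le_iff:
  fixes x y :: real
  shows "0 < x \<Longrightarrow> ln x \<le> y \<longleftrightarrow> x \<le> exp y"
  by (metis exp_le_cancel_iff exp_ln)

lemma ereal_le_ext_ln_divide:
  assumes "n \<ge> 1" "exp (- (real n * c)) \<le> p"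
  shows "- ereal c \<le> ext_ln p / ereal (real n)"
proof -
  have p: "0 < p" using assms(2) exp_gt_zero[of "- (real n * c)"] by linarith
  have "- (real n * c) \<le> ln p" using assms(2) p by (simp add: ln_ge_iff)
  then have "- c \<le> ln p / real n" using assms(1) by (simp add: field_simps)
  then show ?thesis using p assms(1) by (simp add: ext_ln_def)
qed

lemma ext_ln_divide_le_ereal:
  assumes "n \<ge> 1" "p \<le> exp (- (real n * c))"
  shows "ext_ln p / ereal (real n) \<le> - ereal c"
proof (cases "p > 0")
  case True
  have "ln p \<le> - (real n * c)" using assms(2) True by (simp add: ln_le_iff)
  then have "ln p / real n \<le> - c" using assms(1) by (simp add: field_simps)
  then show ?thesis using True assms(1) by (simp add: ext_ln_def)
next
  case False
  then show ?thesis using assms(1) by (simp add: ext_ln_def)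
qed

text \<open>Lets an arbitrarily small gap between rates absorb the constant factors that arise when
  an event is split into finitely many pieces.\<close>

lemma eventually_mult_exp_le:
  fixes a b C :: real
  assumes "a < b"
  shows "\<forall>\<^sub>F n in sequentially. C * exp (real n * a) \<le> exp (real n * b)"
proof -
  have "\<forall>\<^sub>F n in sequentially. C / (b - a) \<le> real n"
    by real_asymp
  then show ?thesis
  proof eventually_elim
    case (elim n)
    have "C \<le> real n * (b - a)" using elim assms by (simp add: field_simps)
    also have "\<dots> \<le> exp (real n * (b - a))"
      using exp_ge_add_one_self[of "real n * (b - a)"] by linarith
    also have "\<dots> = exp (real n * b) / exp (real n * a)"
      by (simp add: exp_diff[symmetric] algebra_simps)
    finally show ?case by (simp add: pos_le_divide_eq)
  qed
qed

locale gaertner_ellis = prob_space M for M :: "'w measure" +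
  fixes Y :: "nat \<Rightarrow> 'w \<Rightarrow> real" and \<Lambda> D :: "real \<Rightarrow> real"
  assumes measurable_Y: "n \<ge> 1 \<Longrightarrow> Y n \<in> borel_measurable M"
    and integrable_exp: "n \<ge> 1 \<Longrightarrow> integrable M (\<lambda>\<omega>. exp (\<theta> * Y n \<omega>))"
    and scaled_log_mgf_lim: "scaled_log_mgf M Y \<theta> \<longlonglongrightarrow> \<Lambda> \<theta>"
    and deriv_limit: "(\<Lambda> has_real_derivative D \<theta>) (at \<theta>)"
begin

abbreviation "mgf n \<theta> \<equiv> (\<integral>\<omega>. exp (\<theta> * Y n \<omega>) \<partial>M)"
abbreviation "I \<equiv> legendre_transform \<Lambda>"

lemma mgf_pos: assumes "n \<ge> 1" shows "0 < mgf n \<theta>"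
proof -
  have "(\<integral>\<omega>. (0::real) \<partial>M) < mgf n \<theta>"
    by (rule integral_less_AE_space) (use assms integrable_exp in \<open>auto simp: emeasure_space_1\<close>)
  then show ?thesis by simp
qed

lemma eventually_mgf_bounds:
  assumes "\<epsilon> > 0"
  shows "\<forall>\<^sub>F n in sequentially. exp (real n * (\<Lambda> \<theta> - \<epsilon>)) \<le> mgf n \<theta> \<and> mgf n \<theta> \<le> exp (real n * (\<Lambda> \<theta> + \<epsilon>))"
proof -
  have "\<forall>\<^sub>F n in sequentially. dist (scaled_log_mgf M Y \<theta> n) (\<Lambda> \<theta>) < \<epsilon>"
    using scaled_log_mgf_lim assms by (rule tendstoD)
  then show ?thesis using eventually_ge_at_top[of 1]
  proof eventually_elim
    case (elim n)
    have "\<bar>ln (mgf n \<theta>) / real n - \<Lambda> \<theta>\<bar> < \<epsilon>"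
      using elim(1) by (simp add: scaled_log_mgf_def dist_real_def)
    then have "\<Lambda> \<theta> - \<epsilon> \<le> ln (mgf n \<theta>) / real n" "ln (mgf n \<theta>) / real n \<le> \<Lambda> \<theta> + \<epsilon>"
      by linarith+
    then have "real n * (\<Lambda> \<theta> - \<epsilon>) \<le> ln (mgf n \<theta>)" "ln (mgf n \<theta>) \<le> real n * (\<Lambda> \<theta> + \<epsilon>)"
      using elim(2) by (simp_all add: field_simps)
    then show ?case using mgf_pos[OF elim(2), of \<theta>] by (simp add: ln_ge_iff ln_le_iff)
  qed
qed

section \<open>Convexity of the limiting pressure and the range of its derivative\<close>

lemma limit_0: "\<Lambda> 0 = 0"
proof -
  have "scaled_log_mgf M Y 0 \<longlonglongrightarrow> 0"
    by (simp add: scaled_log_mgf_def[abs_def] prob_space)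
  then show ?thesis using scaled_log_mgf_lim LIMSEQ_unique by blast
qed

lemma convex_limit: "convex_on UNIV \<Lambda>"
proof (rule convex_onI)
  fix t a b :: real assume t: "0 < t" "t < 1"
  let ?c = "(1 - t) * a + t * b"
  have fin: "scaled_log_mgf M Y ?c n \<le> (1 - t) * scaled_log_mgf M Y a n + t * scaled_log_mgf M Y b n"
    if n: "n \<ge> 1" for n
  proof -
    define A B where "A = ln (mgf n a)" and "B = ln (mgf n b)"
    have eA: "exp A = mgf n a" and eB: "exp B = mgf n b"
      unfolding A_def B_def using mgf_pos[OF n] by simp_all
    \<comment> \<open>Hoelder's inequality by normalization: the two exponentials on the right have
      integral 1 after division by \<open>exp A\<close> and \<open>exp B\<close>, so pointwise
      convexity of \<open>exp\<close> suffices.\<close>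
    have "exp (?c * Y n \<omega> - ((1 - t) * A + t * B))
        \<le> (1 - t) * (exp (a * Y n \<omega>) / exp A) + t * (exp (b * Y n \<omega>) / exp B)" for \<omega>
    proof -
      have "exp ((1 - t) *\<^sub>R (a * Y n \<omega> - A) + t *\<^sub>R (b * Y n \<omega> - B))
        \<le> (1 - t) * exp (a * Y n \<omega> - A) + t * exp (b * Y n \<omega> - B)"
        by (rule convex_onD[OF exp_convex]) (use t in auto)
      then show ?thesis by (simp add: exp_diff algebra_simps)
    qed
    then have "(\<integral>\<omega>. exp (?c * Y n \<omega>) / exp ((1 - t) * A + t * B) \<partial>M)
      \<le> (\<integral>\<omega>. (1 - t) * (exp (a * Y n \<omega>) / exp A) + t * (exp (b * Y n \<omega>) / exp B) \<partial>M)"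
      by (intro integral_mono Bochner_Integration.integrable_add integrable_mult_right
          integrable_divide integrable_exp n) (auto simp: exp_diff)
    also have "\<dots> = (1 - t) * (mgf n a / exp A) + t * (mgf n b / exp B)"
      using integrable_exp[OF n] by simp
    also have "\<dots> = 1" using mgf_pos[OF n, of a] mgf_pos[OF n, of b] by (simp add: eA eB)
    finally have "mgf n ?c \<le> exp ((1 - t) * A + t * B)"
      by (simp add: divide_le_eq)
    then have "ln (mgf n ?c) \<le> (1 - t) * A + t * B"
      using mgf_pos[OF n] by (simp add: ln_le_iff)
    then have "ln (mgf n ?c) / real n \<le> ((1 - t) * A + t * B) / real n"
      using n by (simp add: divide_right_mono)
    then show ?thesis unfolding scaled_log_mgf_def A_def B_def by (simp add: add_divide_distrib)
  qed
  have "\<Lambda> ?c \<le> (1 - t) * \<Lambda> a + t * \<Lambda> b"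
  proof (rule LIMSEQ_le)
    show "scaled_log_mgf M Y ?c \<longlonglongrightarrow> \<Lambda> ?c" by (rule scaled_log_mgf_lim)
    show "(\<lambda>n. (1 - t) * scaled_log_mgf M Y a n + t * scaled_log_mgf M Y b n)
        \<longlonglongrightarrow> (1 - t) * \<Lambda> a + t * \<Lambda> b"
      by (intro tendsto_intros scaled_log_mgf_lim)
    show "\<exists>N. \<forall>n\<ge>N. scaled_log_mgf M Y ?c n
        \<le> (1 - t) * scaled_log_mgf M Y a n + t * scaled_log_mgf M Y b n"
      using fin by blast
  qed
  then show "\<Lambda> ((1 - t) *\<^sub>R a + t *\<^sub>R b) \<le> (1 - t) * \<Lambda> a + t * \<Lambda> b" by simp
qed simp

lemma above_tangent: "\<Lambda> \<mu> \<ge> \<Lambda> \<theta> + D \<theta> * (\<mu> - \<theta>)"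
  using convex_on_imp_above_tangent[OF convex_limit, of \<theta> \<mu> "D \<theta>"] deriv_limit[of \<theta>] by simp

lemma D_less_imp_less: assumes "D a < D b" shows "a < b"
proof (rule ccontr)
  assume "\<not> a < b"
  then have "0 \<le> (D b - D a) * (a - b)" using assms by simp
  moreover have "D b * (a - b) \<le> \<Lambda> a - \<Lambda> b" "D a * (b - a) \<le> \<Lambda> b - \<Lambda> a"
    using above_tangent[of b a] above_tangent[of a b] by linarith+
  ultimately have "(D b - D a) * (a - b) = 0" by (simp add: algebra_simps)
  then show False using assms by auto
qed

text \<open>Darboux's argument: \<open>\<Lambda> \<mu> - z * \<mu>\<close> falls to the right of
  \<open>a\<close> and rises towards \<open>b\<close>, so its minimum on [a, b] is interior and its
  derivative vanishes there.\<close>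

lemma D_between: assumes "D a < z" "z < D b" shows "\<exists>\<theta>. D \<theta> = z"
proof -
  have ab: "a < b" using assms D_less_imp_less by force
  define g where "g \<mu> = \<Lambda> \<mu> - z * \<mu>" for \<mu>
  have g': "(g has_real_derivative D \<mu> - z) (at \<mu>)" for \<mu>
    unfolding g_def by (auto intro!: derivative_eq_intros deriv_limit)
  have "continuous_on {a..b} g"
    using g' by (meson DERIV_continuous_on DERIV_subset subset_UNIV has_field_derivative_at_within)
  then obtain c where c: "c \<in> {a..b}" "\<And>y. y \<in> {a..b} \<Longrightarrow> g c \<le> g y"
    using continuous_attains_inf[of "{a..b}" g] ab by auto
  have "c \<noteq> a"
  proof
    assume "c = a"
    obtain d where d: "d > 0" "\<And>h. 0 < h \<Longrightarrow> h < d \<Longrightarrow> g (a + h) < g a"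
      using DERIV_neg_dec_right[OF g'[of a]] assms by auto
    define h where "h = min (d / 2) (b - a)"
    have "0 < h" "h < d" "a + h \<in> {a..b}" using d ab by (auto simp: h_def min_def)
    then show False using d(2)[of h] c(2)[of "a + h"] \<open>c = a\<close> by simp
  qed
  moreover have "c \<noteq> b"
  proof
    assume "c = b"
    obtain d where d: "d > 0" "\<And>h. 0 < h \<Longrightarrow> h < d \<Longrightarrow> g (b - h) < g b"
      using DERIV_pos_inc_left[OF g'[of b]] assms by auto
    define h where "h = min (d / 2) (b - a)"
    have "0 < h" "h < d" "b - h \<in> {a..b}" using d ab by (auto simp: h_def min_def)
    then show False using d(2)[of h] c(2)[of "b - h"] \<open>c = b\<close> by simp
  qed
  ultimately have cab: "a < c" "c < b" using c(1) by auto
  have "D c - z = 0"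
  proof (rule DERIV_local_min[OF g'])
    show "0 < min (c - a) (b - c)" using cab by simp
    show "\<forall>y. \<bar>c - y\<bar> < min (c - a) (b - c) \<longrightarrow> g c \<le> g y"
      using c(2) by (auto simp: abs_if split: if_splits)
  qed
  then show ?thesis by (intro exI[of _ c]) simp
qed

section \<open>The Legendre transform: contact points, domain of finiteness, strict
  convexity\<close>

lemma I_upper: "ereal (\<theta> * x - \<Lambda> \<theta>) \<le> I x"
  unfolding legendre_transform_def by (rule SUP_upper) simp

lemma I_at_D: "I (D \<theta>) = ereal (\<theta> * D \<theta> - \<Lambda> \<theta>)"
proof (rule antisym)
  show "I (D \<theta>) \<le> ereal (\<theta> * D \<theta> - \<Lambda> \<theta>)"
    unfolding legendre_transform_def
    by (rule SUP_least) (use above_tangent[of \<theta>] in \<open>simp add: algebra_simps\<close>)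
qed (rule I_upper)

text \<open>The function \<open>\<mu> * x - \<Lambda> \<mu>\<close> has nonzero derivative at
  \<theta>, so \<theta> does not maximize it. Thus the line of slope \<theta> touches the graph of
  \<open>I\<close> only above \<open>D \<theta>\<close>.\<close>

lemma I_strict: assumes "x \<noteq> D \<theta>" shows "ereal (\<theta> * x - \<Lambda> \<theta>) < I x"
proof -
  define g where "g \<mu> = \<mu> * x - \<Lambda> \<mu>" for \<mu>
  have g': "(g has_real_derivative x - D \<theta>) (at \<theta>)"
    unfolding g_def by (auto intro!: derivative_eq_intros deriv_limit)
  have "\<exists>\<mu>. g \<theta> < g \<mu>"
  proof (cases "x > D \<theta>")
    case True
    then obtain d where d: "d > 0" "\<And>h. 0 < h \<Longrightarrow> h < d \<Longrightarrow> g \<theta> < g (\<theta> + h)"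
      using DERIV_pos_inc_right[OF g'] by auto
    show ?thesis using d(2)[of "d / 2"] d(1) by auto
  next
    case False
    then obtain d where d: "d > 0" "\<And>h. 0 < h \<Longrightarrow> h < d \<Longrightarrow> g \<theta> < g (\<theta> - h)"
      using DERIV_neg_dec_left[OF g'] assms by auto
    show ?thesis using d(2)[of "d / 2"] d(1) by auto
  qed
  then obtain \<mu> where "g \<theta> < g \<mu>" by blast
  then have "ereal (\<theta> * x - \<Lambda> \<theta>) < ereal (\<mu> * x - \<Lambda> \<mu>)" by (simp add: g_def)
  also have "\<dots> \<le> I x" by (rule I_upper)
  finally show ?thesis .
qed

lemma I_nonneg: "0 \<le> I x"
  using I_upper[of 0 x] by (simp add: limit_0 zero_ereal_def)

lemma limit_le_D_mult: "\<Lambda> \<theta> \<le> D \<theta> * \<theta>"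
  using above_tangent[of \<theta> 0] limit_0 by simp

text \<open>If all slopes were at most \<open>y\<close>, then
  \<open>\<Lambda> \<theta> \<le> y * \<theta>\<close> for positive \<theta>, and
  \<open>\<theta> * x - \<Lambda> \<theta> \<ge> \<theta> * (x - y)\<close> would be
  unbounded.\<close>

lemma finite_I_imp_D_greater: assumes "I x < \<infinity>" "y < x" shows "\<exists>\<theta>. y < D \<theta>"
proof (rule ccontr)
  assume "\<not> ?thesis"
  then have D: "D \<theta> \<le> y" for \<theta> by (meson not_le)
  obtain r where r: "I x = ereal r" using assms(1) I_nonneg[of x] by (cases "I x") auto
  have bound: "\<theta> * (x - y) \<le> r" if "0 \<le> \<theta>" for \<theta>
  proof -
    have "\<Lambda> \<theta> \<le> y * \<theta>" using limit_le_D_mult[of \<theta>] mult_right_mono[OF D[of \<theta>] that] by linarith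
    moreover have "\<theta> * x - \<Lambda> \<theta> \<le> r" using I_upper[of \<theta> x] r by simp
    ultimately show ?thesis by (simp add: algebra_simps)
  qed
  have "0 \<le> r" using bound[of 0] by simp
  then have "(r + 1) / (x - y) * (x - y) \<le> r" using assms by (intro bound) simp
  then show False using assms by simp
qed

lemma finite_I_imp_D_less: assumes "I x < \<infinity>" "x < y" shows "\<exists>\<theta>. D \<theta> < y"
proof (rule ccontr)
  assume "\<not> ?thesis"
  then have D: "y \<le> D \<theta>" for \<theta> by (meson not_le)
  obtain r where r: "I x = ereal r" using assms(1) I_nonneg[of x] by (cases "I x") auto
  have bound: "\<theta> * (y - x) \<le> r" if "0 \<le> \<theta>" for \<theta>
  proof -
    have "\<Lambda> (- \<theta>) \<le> - (y * \<theta>)"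
      using limit_le_D_mult[of "-\<theta>"] mult_right_mono[OF D[of "-\<theta>"] that] by simp
    moreover have "- \<theta> * x - \<Lambda> (- \<theta>) \<le> r" using I_upper[of "- \<theta>" x] r by simp
    ultimately show ?thesis by (simp add: algebra_simps)
  qed
  have "0 \<le> r" using bound[of 0] by simp
  then have "(r + 1) / (y - x) * (y - x) \<le> r" using assms by (intro bound) simp
  then show False using assms by simp
qed

lemma strictly_between_imp_D:
  assumes "I x < \<infinity>" "I y < \<infinity>" "x < z" "z < y" shows "\<exists>\<theta>. D \<theta> = z"
  using finite_I_imp_D_less[OF assms(1,3)] finite_I_imp_D_greater[OF assms(2,4)] D_between by blast

text \<open>The intermediate point is some \<open>D \<theta>\<close>, where \<open>I\<close> equals
  the affine function \<open>\<theta> * z - \<Lambda> \<theta>\<close>. By \<open>I_strict\<close>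
  this function is strictly below \<open>I\<close> at both endpoints.\<close>

theorem strictly_convex_I: "strictly_convex_where_finite I"
  unfolding strictly_convex_where_finite_def
proof (intro allI impI, elim conjE)
  fix x y t :: real
  assume *: "I x < \<infinity>" "I y < \<infinity>" "x \<noteq> y" "0 < t" "t < 1"
  let ?z = "(1 - t) *\<^sub>R x + t *\<^sub>R y"
  have zx: "?z - x = t * (y - x)" and yz: "y - ?z = (1 - t) * (y - x)" by (simp_all add: algebra_simps)
  have "\<exists>\<theta>. D \<theta> = ?z"
  proof (cases "x < y")
    case True
    have "0 < ?z - x" "0 < y - ?z" unfolding zx yz using True * by simp_all
    then show ?thesis using strictly_between_imp_D[OF *(1,2)] by simp
  next
    case False
    have "?z - x < 0" "y - ?z < 0" unfolding zx yz using False * by (simp_all add: mult_pos_neg)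
    then show ?thesis using strictly_between_imp_D[OF *(2,1)] by simp
  qed
  then obtain \<theta> where \<theta>: "D \<theta> = ?z" by blast
  have "?z - x \<noteq> 0" "y - ?z \<noteq> 0" unfolding zx yz using * by auto
  then have "x \<noteq> D \<theta>" "y \<noteq> D \<theta>" unfolding \<theta> by auto
  then have less: "ereal (\<theta> * x - \<Lambda> \<theta>) < I x" "ereal (\<theta> * y - \<Lambda> \<theta>) < I y"
    by (simp_all add: I_strict)
  obtain p where p: "I x = ereal p" using *(1) I_nonneg[of x] by (cases "I x") auto
  obtain q where q: "I y = ereal q" using *(2) I_nonneg[of y] by (cases "I y") auto
  have "(1 - t) * (\<theta> * x - \<Lambda> \<theta>) + t * (\<theta> * y - \<Lambda> \<theta>) < (1 - t) * p + t * q"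
    using less * unfolding p q by (intro add_strict_mono mult_strict_left_mono) auto
  moreover have "\<theta> * ?z - \<Lambda> \<theta> = (1 - t) * (\<theta> * x - \<Lambda> \<theta>) + t * (\<theta> * y - \<Lambda> \<theta>)"
    by (simp add: algebra_simps)
  ultimately have "\<theta> * ?z - \<Lambda> \<theta> < (1 - t) * p + t * q" by linarith
  then show "I ?z < ereal (1 - t) * I x + ereal t * I y"
    using I_at_D[of \<theta>] unfolding \<theta> p q by simp
qed

lemma good_rate_function_I: "good_rate_function I"
  unfolding good_rate_function_def
proof (intro conjI allI)
  fix a :: real
  have eq: "{x. I x \<le> ereal a} = (\<Inter>\<theta>. {x. \<theta> * x - \<Lambda> \<theta> \<le> a})"
    by (auto simp: legendre_transform_def SUP_le_iff)
  have "closed {x. I x \<le> ereal a}" unfolding eq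
    by (intro closed_INT ballI closed_Collect_le continuous_intros)
  moreover have "{x. I x \<le> ereal a} \<subseteq> {- (a + \<Lambda> (-1)) .. a + \<Lambda> 1}"
  proof
    fix x assume "x \<in> {x. I x \<le> ereal a}"
    then have "\<theta> * x - \<Lambda> \<theta> \<le> a" for \<theta> using eq by auto
    from this[of 1] this[of "-1"] show "x \<in> {- (a + \<Lambda> (-1)) .. a + \<Lambda> 1}" by auto
  qed
  ultimately show "compact {x. I x \<le> ereal a}"
    by (metis compact_Icc compact_eq_bounded_closed bounded_subset)
qed (rule I_nonneg)

section \<open>Exponential tilting and the lower bound\<close>

lemma tilted_tail_le:
  assumes n: "n \<ge> 1"
  shows "(\<integral>\<omega>. exp (\<theta> * Y n \<omega>) * indicator {\<omega> \<in> space M. \<eta> * (real n * b) \<le> \<eta> * Y n \<omega>} \<omega> \<partial>M)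
    \<le> exp (- (\<eta> * (real n * b))) * mgf n (\<theta> + \<eta>)"
proof -
  note [measurable] = measurable_Y[OF n]
  have "(\<integral>\<omega>. exp (\<theta> * Y n \<omega>) * indicator {\<omega> \<in> space M. \<eta> * (real n * b) \<le> \<eta> * Y n \<omega>} \<omega> \<partial>M)
    \<le> (\<integral>\<omega>. exp (- (\<eta> * (real n * b))) * exp ((\<theta> + \<eta>) * Y n \<omega>) \<partial>M)"
  proof (rule integral_mono)
    show "integrable M (\<lambda>\<omega>. exp (\<theta> * Y n \<omega>) * indicator {\<omega> \<in> space M. \<eta> * (real n * b) \<le> \<eta> * Y n \<omega>} \<omega>)"
      by (intro integrable_real_mult_indicator integrable_exp n) measurable
    show "integrable M (\<lambda>\<omega>. exp (- (\<eta> * (real n * b))) * exp ((\<theta> + \<eta>) * Y n \<omega>))"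
      by (intro integrable_mult_right integrable_exp n)
    show "exp (\<theta> * Y n \<omega>) * indicator {\<omega> \<in> space M. \<eta> * (real n * b) \<le> \<eta> * Y n \<omega>} \<omega>
      \<le> exp (- (\<eta> * (real n * b))) * exp ((\<theta> + \<eta>) * Y n \<omega>)" for \<omega>
      by (auto simp: indicator_def exp_add[symmetric] algebra_simps)
  qed
  then show ?thesis by simp
qed

text \<open>The sign of \<open>\<eta>\<close> selects the upper or the lower tail, and
  \<open>\<theta> = 0\<close> recovers the ordinary Chernoff bound.\<close>

lemma eventually_tilted_tail_le:
  assumes "\<Lambda> (\<theta> + \<eta>) - \<eta> * b < c"
  shows "\<forall>\<^sub>F n in sequentially.
    (\<integral>\<omega>. exp (\<theta> * Y n \<omega>) * indicator {\<omega> \<in> space M. \<eta> * (real n * b) \<le> \<eta> * Y n \<omega>} \<omega> \<partial>M)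
    \<le> exp (real n * c)"
proof -
  define \<epsilon> where "\<epsilon> = c - (\<Lambda> (\<theta> + \<eta>) - \<eta> * b)"
  have "\<epsilon> > 0" using assms by (simp add: \<epsilon>_def)
  from eventually_mgf_bounds[OF this, of "\<theta> + \<eta>"] eventually_ge_at_top[of 1]
  show ?thesis
  proof eventually_elim
    case (elim n)
    have "exp (- (\<eta> * (real n * b))) * mgf n (\<theta> + \<eta>)
        \<le> exp (- (\<eta> * (real n * b))) * exp (real n * (\<Lambda> (\<theta> + \<eta>) + \<epsilon>))"
      using elim by (intro mult_left_mono) auto
    also have "\<dots> = exp (real n * c)"
      by (simp add: exp_add[symmetric] \<epsilon>_def algebra_simps)
    finally show ?case using tilted_tail_le[OF elim(2), of \<theta> \<eta> b] by linarith
  qed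
qed

text \<open>Cramer's change of measure, written without the tilted measure: the integral defining
  \<open>mgf n \<theta>\<close> is split, and its tails away from \<open>D \<theta>\<close> have a
  strictly smaller rate. The window around \<open>D \<theta>\<close> carries the rest, and there the
  integrand is at most \<open>exp (n * (\<theta> * D \<theta> + \<epsilon>))\<close>.\<close>

lemma eventually_prob_ge:
  assumes U: "open U" "D \<theta> \<in> U" and c: "\<theta> * D \<theta> - \<Lambda> \<theta> < c"
  shows "\<forall>\<^sub>F n in sequentially. exp (- (real n * c)) \<le> \<P>(\<omega> in M. Y n \<omega> / real n \<in> U)"
proof -
  define x where "x = D \<theta>"
  \<comment> \<open>Half of the slack is spent on the lower bound for \<open>mgf n \<theta>\<close>,
    the other half on the variation of the integrand over the window of radius
    \<open>\<delta>\<close>.\<close>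
  define \<epsilon> where "\<epsilon> = (c - (\<theta> * x - \<Lambda> \<theta>)) / 2"
  have \<epsilon>: "\<epsilon> > 0" using c by (simp add: \<epsilon>_def x_def)
  obtain r where r: "r > 0" "ball x r \<subseteq> U" using U by (auto simp: x_def open_contains_ball)
  define \<delta> where "\<delta> = min r (\<epsilon> / (\<bar>\<theta>\<bar> + 1))"
  have \<delta>: "\<delta> > 0" using r \<epsilon> by (simp add: \<delta>_def)
  have "\<bar>\<theta>\<bar> * \<delta> \<le> (\<bar>\<theta>\<bar> + 1) * (\<epsilon> / (\<bar>\<theta>\<bar> + 1))"
    using \<delta> by (intro mult_mono) (auto simp: \<delta>_def)
  then have \<theta>\<delta>: "\<bar>\<theta>\<bar> * \<delta> \<le> \<epsilon>" by simp
  have ball: "y \<in> U" if "\<bar>y - x\<bar> < \<delta>" for y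
    using r(2) that by (auto simp: \<delta>_def dist_real_def ball_def abs_minus_commute)
  \<comment> \<open>Differentiability of \<Lambda> at \<theta> is used here: a small further tilt to
    either side makes the corresponding tail rate strictly smaller than
    \<open>\<Lambda> \<theta>\<close>.\<close>
  have d1: "((\<lambda>\<mu>. \<Lambda> \<mu> - (x + \<delta>) * \<mu>) has_real_derivative - \<delta>) (at \<theta>)"
    by (auto intro!: derivative_eq_intros deriv_limit simp: x_def)
  have d2: "((\<lambda>\<mu>. \<Lambda> \<mu> - (x - \<delta>) * \<mu>) has_real_derivative \<delta>) (at \<theta>)"
    by (auto intro!: derivative_eq_intros deriv_limit simp: x_def)
  obtain e1 where e1: "e1 > 0"
    "\<And>h. 0 < h \<Longrightarrow> h < e1 \<Longrightarrow> \<Lambda> (\<theta> + h) - (x + \<delta>) * (\<theta> + h) < \<Lambda> \<theta> - (x + \<delta>) * \<theta>"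
    using DERIV_neg_dec_right[OF d1] \<delta> by auto
  obtain e2 where e2: "e2 > 0"
    "\<And>h. 0 < h \<Longrightarrow> h < e2 \<Longrightarrow> \<Lambda> (\<theta> - h) - (x - \<delta>) * (\<theta> - h) < \<Lambda> \<theta> - (x - \<delta>) * \<theta>"
    using DERIV_pos_inc_left[OF d2] \<delta> by auto
  define \<eta> where "\<eta> = min e1 e2 / 2"
  have \<eta>: "0 < \<eta>" "\<eta> < e1" "\<eta> < e2" using e1(1) e2(1) by (auto simp: \<eta>_def min_def)
  have t1: "\<Lambda> (\<theta> + \<eta>) - \<eta> * (x + \<delta>) < \<Lambda> \<theta>" using e1(2)[OF \<eta>(1,2)] by (simp add: algebra_simps)
  have t2: "\<Lambda> (\<theta> + - \<eta>) - (- \<eta>) * (x - \<delta>) < \<Lambda> \<theta>" using e2(2)[OF \<eta>(1,3)] by (simp add: algebra_simps)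
  obtain a where a: "a < \<Lambda> \<theta>" "\<Lambda> (\<theta> + \<eta>) - \<eta> * (x + \<delta>) < a" "\<Lambda> (\<theta> + - \<eta>) - (- \<eta>) * (x - \<delta>) < a"
    using dense[of "max (\<Lambda> (\<theta> + \<eta>) - \<eta> * (x + \<delta>)) (\<Lambda> (\<theta> + - \<eta>) - (- \<eta>) * (x - \<delta>))" "\<Lambda> \<theta>"] t1 t2
    by auto
  \<comment> \<open>An intermediate rate: the two tails take at most two thirds of
    \<open>exp (n * (\<Lambda> \<theta> - \<epsilon>'))\<close>, and the remaining third still
    exceeds \<open>exp (n * (\<Lambda> \<theta> - \<epsilon>))\<close>.\<close>
  define \<epsilon>' where "\<epsilon>' = min \<epsilon> (\<Lambda> \<theta> - a) / 2"
  have \<epsilon>': "\<epsilon>' > 0" "\<Lambda> \<theta> - \<epsilon> < \<Lambda> \<theta> - \<epsilon>'" "a < \<Lambda> \<theta> - \<epsilon>'" using \<epsilon> a(1) by (auto simp: \<epsilon>'_def min_def field_simps)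
  show ?thesis
    using eventually_mgf_bounds[OF \<epsilon>'(1), of \<theta>] eventually_tilted_tail_le[OF a(2)]
      eventually_tilted_tail_le[OF a(3)] eventually_mult_exp_le[OF \<epsilon>'(2), of 3]
      eventually_mult_exp_le[OF \<epsilon>'(3), of 3] eventually_ge_at_top[of 1]
  proof eventually_elim
    case (elim n)
    note n = \<open>1 \<le> n\<close>
    note [measurable] = measurable_Y[OF n]
    let ?S = "{\<omega> \<in> space M. Y n \<omega> / real n \<in> U}"
    let ?A = "{\<omega> \<in> space M. \<bar>Y n \<omega> / real n - x\<bar> < \<delta>}"
    let ?T1 = "{\<omega> \<in> space M. \<eta> * (real n * (x + \<delta>)) \<le> \<eta> * Y n \<omega>}"
    let ?T2 = "{\<omega> \<in> space M. (- \<eta>) * (real n * (x - \<delta>)) \<le> (- \<eta>) * Y n \<omega>}"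
    have [measurable]: "U \<in> sets borel" using U(1) by simp
    have int: "integrable M (\<lambda>\<omega>. exp (\<theta> * Y n \<omega>) * indicator B \<omega>)" if "B \<in> sets M" for B
      using that by (intro integrable_real_mult_indicator integrable_exp n)
    have sA: "?A \<in> sets M" and s1: "?T1 \<in> sets M" and s2: "?T2 \<in> sets M" by measurable
    have cover: "\<omega> \<in> ?A \<or> \<omega> \<in> ?T1 \<or> \<omega> \<in> ?T2" if "\<omega> \<in> space M" for \<omega>
    proof -
      consider "\<bar>Y n \<omega> / real n - x\<bar> < \<delta>" | "x + \<delta> \<le> Y n \<omega> / real n" | "Y n \<omega> / real n \<le> x - \<delta>"
        by linarith
      then show ?thesis
      proof cases
        case 2
        then have "real n * (x + \<delta>) \<le> Y n \<omega>" using n by (simp add: field_simps)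
        then show ?thesis using that \<eta>(1) by simp
      next
        case 3
        then have "Y n \<omega> \<le> real n * (x - \<delta>)" using n by (simp add: field_simps)
        then show ?thesis using that \<eta>(1) by simp
      qed (use that in simp)
    qed
    have "mgf n \<theta> \<le> (\<integral>\<omega>. exp (\<theta> * Y n \<omega>) * indicator ?A \<omega> + (exp (\<theta> * Y n \<omega>) * indicator ?T1 \<omega>
        + exp (\<theta> * Y n \<omega>) * indicator ?T2 \<omega>) \<partial>M)"
    proof (rule integral_mono)
      show "integrable M (\<lambda>\<omega>. exp (\<theta> * Y n \<omega>))" by (rule integrable_exp[OF n])
      show "integrable M (\<lambda>\<omega>. exp (\<theta> * Y n \<omega>) * indicator ?A \<omega> + (exp (\<theta> * Y n \<omega>) * indicator ?T1 \<omega>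
        + exp (\<theta> * Y n \<omega>) * indicator ?T2 \<omega>))"
        by (intro Bochner_Integration.integrable_add int sA s1 s2)
      fix \<omega> assume "\<omega> \<in> space M"
      then consider "\<omega> \<in> ?A" | "\<omega> \<in> ?T1" | "\<omega> \<in> ?T2" using cover by blast
      then show "exp (\<theta> * Y n \<omega>) \<le> exp (\<theta> * Y n \<omega>) * indicator ?A \<omega> + (exp (\<theta> * Y n \<omega>) * indicator ?T1 \<omega>
        + exp (\<theta> * Y n \<omega>) * indicator ?T2 \<omega>)"
        by cases (simp_all add: indicator_def)
    qed
    also have "\<dots> = (\<integral>\<omega>. exp (\<theta> * Y n \<omega>) * indicator ?A \<omega> \<partial>M)
        + ((\<integral>\<omega>. exp (\<theta> * Y n \<omega>) * indicator ?T1 \<omega> \<partial>M)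
        + (\<integral>\<omega>. exp (\<theta> * Y n \<omega>) * indicator ?T2 \<omega> \<partial>M))"
      by (simp only: Bochner_Integration.integral_add int sA s1 s2 Bochner_Integration.integrable_add)
    also have "\<dots> \<le> (\<integral>\<omega>. exp (\<theta> * Y n \<omega>) * indicator ?A \<omega> \<partial>M) + (exp (real n * a) + exp (real n * a))"
      using elim(2,3) by (intro add_mono) auto
    finally have lo: "exp (real n * (\<Lambda> \<theta> - \<epsilon>)) \<le> (\<integral>\<omega>. exp (\<theta> * Y n \<omega>) * indicator ?A \<omega> \<partial>M)"
      using elim(1,4,5) by linarith
    have "(\<integral>\<omega>. exp (\<theta> * Y n \<omega>) * indicator ?A \<omega> \<partial>M)
      \<le> (\<integral>\<omega>. exp (real n * (\<theta> * x + \<epsilon>)) * indicator ?S \<omega> \<partial>M)"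
    proof (rule integral_mono)
      show "integrable M (\<lambda>\<omega>. exp (\<theta> * Y n \<omega>) * indicator ?A \<omega>)" by (intro int sA)
      show "integrable M (\<lambda>\<omega>. exp (real n * (\<theta> * x + \<epsilon>)) * indicator ?S \<omega>)"
        by (intro integrable_mult_right integrable_real_indicator) (auto simp: emeasure_eq_measure)
      fix \<omega> assume \<omega>: "\<omega> \<in> space M"
      show "exp (\<theta> * Y n \<omega>) * indicator ?A \<omega> \<le> exp (real n * (\<theta> * x + \<epsilon>)) * indicator ?S \<omega>"
      proof (cases "\<omega> \<in> ?A")
        case True
        define y where "y = Y n \<omega> / real n"
        have y: "\<bar>y - x\<bar> < \<delta>" using True by (simp add: y_def)
        have "\<theta> * (y - x) \<le> \<bar>\<theta>\<bar> * \<bar>y - x\<bar>" by (metis abs_ge_self abs_mult)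
        also have "\<dots> \<le> \<bar>\<theta>\<bar> * \<delta>" using y by (intro mult_left_mono) auto
        finally have "\<theta> * y \<le> \<theta> * x + \<epsilon>" using \<theta>\<delta> by (simp add: algebra_simps)
        then have "real n * (\<theta> * y) \<le> real n * (\<theta> * x + \<epsilon>)" by (intro mult_left_mono) auto
        moreover have "real n * (\<theta> * y) = \<theta> * Y n \<omega>" using n by (simp add: y_def)
        moreover have "\<omega> \<in> ?S" using ball[OF y] \<omega> by (simp add: y_def)
        ultimately show ?thesis using True by (simp add: indicator_def)
      next
        case False
        then have "indicator ?A \<omega> = (0::real)" by (simp add: indicator_def)
        then show ?thesis by simp
      qed
    qed
    also have "\<dots> = exp (real n * (\<theta> * x + \<epsilon>)) * prob ?S" by (simp add: Int_absorb2 subset_eq)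
    finally have "exp (real n * (\<Lambda> \<theta> - \<epsilon>)) \<le> exp (real n * (\<theta> * x + \<epsilon>)) * prob ?S" using lo by linarith
    then have "exp (real n * (\<Lambda> \<theta> - \<epsilon>)) / exp (real n * (\<theta> * x + \<epsilon>)) \<le> prob ?S"
      by (simp add: divide_le_eq mult.commute)
    moreover have "exp (real n * (\<Lambda> \<theta> - \<epsilon>)) / exp (real n * (\<theta> * x + \<epsilon>)) = exp (- (real n * c))"
      by (simp add: exp_diff[symmetric] \<epsilon>_def algebra_simps)
    ultimately show ?case by simp
  qed
qed

text \<open>At values of \<open>D\<close> this is \<open>eventually_prob_ge\<close>. A boundary
  point of the domain of finiteness need not be such a value; it is approached from the side of
  \<open>D 0\<close>, the zero of \<open>I\<close>, along which convexity keeps \<open>I\<close> no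
  larger.\<close>

lemma liminf_ge:
  assumes U: "open U" "x \<in> U"
  shows "- I x \<le> liminf (\<lambda>n. ext_ln (\<P>(\<omega> in M. Y n \<omega> / real n \<in> U)) / ereal (real n))"
    (is "_ \<le> ?L")
proof (cases "I x < \<infinity>")
  case True
  have at_D: "- I (D \<theta>) \<le> ?L" if "D \<theta> \<in> U" for \<theta>
  proof -
    have "- ?L \<le> I (D \<theta>)" unfolding I_at_D
    proof (rule dense_ge)
      fix e assume e: "ereal (\<theta> * D \<theta> - \<Lambda> \<theta>) < e"
      show "- ?L \<le> e"
      proof (cases e)
        case (real c)
        then have c: "\<theta> * D \<theta> - \<Lambda> \<theta> < c" using e by simp
        have "- ereal c \<le> ?L"
        proof (rule Liminf_bounded)
          show "\<forall>\<^sub>F n in sequentially. - ereal c \<le> ext_ln (\<P>(\<omega> in M. Y n \<omega> / real n \<in> U)) / ereal (real n)"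
            using eventually_prob_ge[OF U(1) that c] eventually_ge_at_top[of 1]
            by eventually_elim (rule ereal_le_ext_ln_divide)
        qed
        then show ?thesis using real ereal_uminus_le_reorder by auto
      qed (use e in auto)
    qed
    then show ?thesis using ereal_uminus_le_reorder by auto
  qed
  show ?thesis
  proof (cases "x = D 0")
    case True
    then show ?thesis using at_D U by simp
  next
    case False
    have I0: "I (D 0) = 0" using I_at_D[of 0] by (simp add: limit_0 zero_ereal_def)
    obtain r where r: "r > 0" "ball x r \<subseteq> U" using U by (auto simp: open_contains_ball)
    \<comment> \<open>Small enough for the point \<open>y\<close> to remain in \<open>U\<close>, yet
      positive, so that \<open>y\<close> lies strictly between two points of finiteness.\<close>
    define t where "t = min (1/2) (r / (2 * \<bar>D 0 - x\<bar>))"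
    have t: "0 < t" "t < 1" using r False by (auto simp: t_def)
    have "t * \<bar>D 0 - x\<bar> \<le> r / (2 * \<bar>D 0 - x\<bar>) * \<bar>D 0 - x\<bar>"
      by (intro mult_right_mono) (auto simp: t_def)
    then have tr: "t * \<bar>D 0 - x\<bar> < r" using r False by auto
    define y where "y = (1 - t) *\<^sub>R x + t *\<^sub>R D 0"
    have yx: "y - x = t * (D 0 - x)" and Dy: "D 0 - y = (1 - t) * (D 0 - x)"
      by (simp_all add: y_def algebra_simps)
    have "\<exists>\<theta>. D \<theta> = y"
    proof (cases "x < D 0")
      case True
      have "0 < y - x" "0 < D 0 - y" unfolding yx Dy using True t by simp_all
      then show ?thesis using strictly_between_imp_D[OF \<open>I x < \<infinity>\<close>, of "D 0" y] I0 by simp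
    next
      case F: False
      have "y - x < 0" "D 0 - y < 0" unfolding yx Dy using F False t by (simp_all add: mult_pos_neg)
      then show ?thesis using strictly_between_imp_D[OF _ \<open>I x < \<infinity>\<close>, of "D 0" y] I0 by simp
    qed
    then obtain \<theta> where \<theta>: "D \<theta> = y" by blast
    have "\<bar>y - x\<bar> < r" unfolding yx using tr t by (simp add: abs_mult)
    then have "y \<in> U" using r(2) by (auto simp: ball_def dist_real_def abs_minus_commute)
    then have L: "- I y \<le> ?L" using at_D[of \<theta>] \<theta> by simp
    have "I y < ereal (1 - t) * I x + ereal t * I (D 0)"
      unfolding y_def using \<open>I x < \<infinity>\<close> False t I0
      by (intro strictly_convex_I[unfolded strictly_convex_where_finite_def, rule_format]) auto
    also have "\<dots> \<le> I x"
    proof -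
      obtain p where p: "I x = ereal p" using \<open>I x < \<infinity>\<close> I_nonneg[of x] by (cases "I x") auto
      have "0 \<le> p" using I_nonneg[of x] p by simp
      then have "(1 - t) * p \<le> 1 * p" using t by (intro mult_right_mono) auto
      then show ?thesis by (simp add: p I0)
    qed
    finally have "- I x \<le> - I y" by simp
    then show ?thesis using L by (rule order_trans)
  qed
qed simp

section \<open>The upper bound\<close>

lemma eventually_half_line_prob_le:
  assumes "c < \<theta> * b - \<Lambda> \<theta>"
  shows "\<forall>\<^sub>F n in sequentially. \<P>(\<omega> in M. \<theta> * b \<le> \<theta> * (Y n \<omega> / real n)) \<le> exp (real n * (- c))"
proof -
  have "\<Lambda> (0 + \<theta>) - \<theta> * b < - c" using assms by simp
  from eventually_tilted_tail_le[OF this] eventually_ge_at_top[of 1] show ?thesis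
  proof eventually_elim
    case (elim n)
    note [measurable] = measurable_Y[OF elim(2)]
    have "{\<omega> \<in> space M. \<theta> * (real n * b) \<le> \<theta> * Y n \<omega>} = {\<omega> \<in> space M. \<theta> * b \<le> \<theta> * (Y n \<omega> / real n)}"
      using elim(2) by (auto simp: field_simps)
    then show ?case using elim(1) by (simp add: Int_absorb2 subset_eq)
  qed
qed

text \<open>The set is cut at the mean \<open>D 0\<close>, and each half lies in a half-line that
  starts at its point nearest to the mean. A Chernoff bound at that point applies, whence the factor
  2.\<close>

lemma eventually_closed_prob_le:
  assumes F: "closed F" "\<And>x. x \<in> F \<Longrightarrow> ereal c < I x" and c: "0 \<le> c"
  shows "\<forall>\<^sub>F n in sequentially. \<P>(\<omega> in M. Y n \<omega> / real n \<in> F) \<le> 2 * exp (real n * (- c))"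
proof -
  have half: "\<forall>\<^sub>F n in sequentially. \<P>(\<omega> in M. Y n \<omega> / real n \<in> G) \<le> exp (real n * (- c))"
    if G: "b \<in> F" "\<And>y. y \<in> G \<Longrightarrow> (b - D 0) * b \<le> (b - D 0) * y" "closed G" for b G
  proof -
    obtain \<theta> where \<theta>: "c < \<theta> * b - \<Lambda> \<theta>"
      using F(2)[OF G(1)] by (auto simp: legendre_transform_def less_SUP_iff)
    \<comment> \<open>The tangent at 0 gives \<open>\<theta> * (b - D 0) \<ge> \<theta> * b -
      \<Lambda> \<theta> > c \<ge> 0\<close>, so the exponent \<theta> points away from the mean, as
      the half-line does.\<close>
    have "\<Lambda> \<theta> \<ge> D 0 * \<theta>" using above_tangent[of 0 \<theta>] limit_0 by simp
    then have pos: "0 < \<theta> * (b - D 0)" using \<theta> c by (simp add: algebra_simps)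
    have imp: "\<theta> * b \<le> \<theta> * y" if "y \<in> G" for y
      using G(2)[OF that] pos by (auto simp: zero_less_mult_iff)
    show ?thesis using eventually_half_line_prob_le[OF \<theta>] eventually_ge_at_top[of 1]
    proof eventually_elim
      case (elim n)
      note [measurable] = measurable_Y[OF elim(2)]
      have "\<P>(\<omega> in M. Y n \<omega> / real n \<in> G) \<le> \<P>(\<omega> in M. \<theta> * b \<le> \<theta> * (Y n \<omega> / real n))"
        using imp by (intro finite_measure_mono subsetI) (auto simp del: times_divide_eq_right)
      then show ?case using elim by linarith
    qed
  qed
  let ?P = "F \<inter> {D 0..}" and ?N = "F \<inter> {..D 0}"
  have cl: "closed ?P" "closed ?N" using F(1) by auto
  have P: "\<forall>\<^sub>F n in sequentially. \<P>(\<omega> in M. Y n \<omega> / real n \<in> ?P) \<le> exp (real n * (- c))"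
  proof (cases "?P = {}")
    case False
    have bdd: "bdd_below ?P" by (rule bdd_belowI[of _ "D 0"]) auto
    have mem: "Inf ?P \<in> ?P" by (rule closed_contains_Inf[OF False bdd cl(1)])
    show ?thesis
    proof (rule half[OF _ _ cl(1)])
      show "Inf ?P \<in> F" using mem by simp
      show "(Inf ?P - D 0) * Inf ?P \<le> (Inf ?P - D 0) * y" if "y \<in> ?P" for y
        using mem cInf_lower[OF that bdd] by (intro mult_left_mono) auto
    qed
  qed simp
  have N: "\<forall>\<^sub>F n in sequentially. \<P>(\<omega> in M. Y n \<omega> / real n \<in> ?N) \<le> exp (real n * (- c))"
  proof (cases "?N = {}")
    case False
    have bdd: "bdd_above ?N" by (rule bdd_aboveI[of _ "D 0"]) auto
    have mem: "Sup ?N \<in> ?N" by (rule closed_contains_Sup[OF False bdd cl(2)])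
    show ?thesis
    proof (rule half[OF _ _ cl(2)])
      show "Sup ?N \<in> F" using mem by simp
      show "(Sup ?N - D 0) * Sup ?N \<le> (Sup ?N - D 0) * y" if "y \<in> ?N" for y
        using mem cSup_upper[OF that bdd] by (intro mult_left_mono_neg) auto
    qed
  qed simp
  show ?thesis using P N eventually_ge_at_top[of 1]
  proof eventually_elim
    case (elim n)
    note [measurable] = measurable_Y[OF elim(3)]
    have [measurable]: "F \<in> sets borel" using F(1) by simp
    have "\<P>(\<omega> in M. Y n \<omega> / real n \<in> F)
        \<le> measure M ({\<omega> \<in> space M. Y n \<omega> / real n \<in> ?P} \<union> {\<omega> \<in> space M. Y n \<omega> / real n \<in> ?N})"
      by (intro finite_measure_mono) auto
    also have "\<dots> \<le> \<P>(\<omega> in M. Y n \<omega> / real n \<in> ?P) + \<P>(\<omega> in M. Y n \<omega> / real n \<in> ?N)"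
      by (intro measure_Un_le) measurable
    finally show ?case using elim by linarith
  qed
qed

lemma limsup_le:
  assumes U: "U \<in> sets borel"
  shows "limsup (\<lambda>n. ext_ln (\<P>(\<omega> in M. Y n \<omega> / real n \<in> U)) / ereal (real n))
    \<le> - (INF x\<in>closure U. I x)" (is "?L \<le> - ?i")
proof -
  have bound: "?L \<le> - ereal c"
    if "\<forall>\<^sub>F n in sequentially. \<P>(\<omega> in M. Y n \<omega> / real n \<in> U) \<le> exp (- (real n * c))" for c
  proof (rule Limsup_bounded)
    show "\<forall>\<^sub>F n in sequentially. ext_ln (\<P>(\<omega> in M. Y n \<omega> / real n \<in> U)) / ereal (real n) \<le> - ereal c"
      using that eventually_ge_at_top[of 1] by eventually_elim (rule ext_ln_divide_le_ereal)
  qed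
  have "?i \<le> - ?L"
  proof (rule dense_le)
    fix e assume e: "e < ?i"
    have "0 \<le> ?i" by (intro INF_greatest I_nonneg)
    show "e \<le> - ?L"
    \<comment> \<open>A negative rate needs only that probabilities are at most 1; the bound for
      closed sets requires \<open>c \<ge> 0\<close>.\<close>
    proof (cases "e < 0")
      case True
      have "?L \<le> - ereal 0" by (rule bound) simp
      then have "0 \<le> - ?L" using ereal_uminus_le_reorder[of 0 ?L] by (simp add: zero_ereal_def[symmetric])
      then show ?thesis using True by (meson less_imp_le order_trans)
    next
      case False
      then obtain c where c: "e = ereal c" "0 \<le> c" using e by (cases e) auto
      \<comment> \<open>A rate strictly between, whose excess over \<open>c\<close> absorbs the
        factor 2.\<close>
      obtain d where d: "ereal c < d" "d < ?i" using dense e c by blast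
      then obtain c' where c': "d = ereal c'" "c < c'" by (cases d) auto
      have less: "ereal c' < I x" if "x \<in> closure U" for x
        using d(2) c'(1) INF_lower[OF that, of I] by (simp add: less_le_trans)
      have "\<forall>\<^sub>F n in sequentially. \<P>(\<omega> in M. Y n \<omega> / real n \<in> closure U) \<le> 2 * exp (real n * (- c'))"
        using c(2) c'(2) by (intro eventually_closed_prob_le less) auto
      moreover have "\<forall>\<^sub>F n in sequentially. 2 * exp (real n * (- c')) \<le> exp (real n * (- c))"
        using c'(2) by (intro eventually_mult_exp_le) simp
      ultimately have "\<forall>\<^sub>F n in sequentially. \<P>(\<omega> in M. Y n \<omega> / real n \<in> U) \<le> exp (- (real n * c))"
        using eventually_ge_at_top[of 1]
      proof eventually_elim
        case (elim n)
        note [measurable] = measurable_Y[OF elim(3)]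
        have [measurable]: "closure U \<in> sets borel" by simp
        have "\<P>(\<omega> in M. Y n \<omega> / real n \<in> U) \<le> \<P>(\<omega> in M. Y n \<omega> / real n \<in> closure U)"
          using closure_subset[of U] by (intro finite_measure_mono) auto
        then show ?case using elim by simp
      qed
      then have "?L \<le> - e" unfolding c by (rule bound)
      then show ?thesis using ereal_minus_le_minus[of "- e" ?L] by (simp only: ereal_uminus_uminus)
    qed
  qed
  then show ?thesis using ereal_minus_le_minus[of "- ?L" ?i] by (simp only: ereal_uminus_uminus)
qed

theorem large_deviation_principle_I: "large_deviation_principle M (\<lambda>n \<omega>. Y n \<omega> / real n) I"
  unfolding large_deviation_principle_def
proof (intro conjI ballI allI impI)
  fix U :: "real set" assume U: "U \<in> sets borel"
  let ?l = "\<lambda>V n. ext_ln (\<P>(\<omega> in M. Y n \<omega> / real n \<in> V)) / ereal (real n)"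
  have mono: "liminf (?l (interior U)) \<le> liminf (?l U)"
  proof (rule Liminf_mono)
    show "\<forall>\<^sub>F n in sequentially. ?l (interior U) n \<le> ?l U n"
      using eventually_ge_at_top[of 1]
    proof eventually_elim
      case (elim n)
      note [measurable] = measurable_Y[OF elim]
      have "\<P>(\<omega> in M. Y n \<omega> / real n \<in> interior U) \<le> \<P>(\<omega> in M. Y n \<omega> / real n \<in> U)"
        using interior_subset[of U] U by (intro finite_measure_mono) auto
      then have "ext_ln (\<P>(\<omega> in M. Y n \<omega> / real n \<in> interior U)) \<le> ext_ln (\<P>(\<omega> in M. Y n \<omega> / real n \<in> U))"
        by (auto simp: ext_ln_def)
      then show ?case using elim by (intro ereal_divide_right_mono) auto
    qed
  qed
  have "- liminf (?l U) \<le> I x" if "x \<in> interior U" for x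
  proof -
    have "- I x \<le> liminf (?l U)"
      using liminf_ge[OF open_interior that] mono by (rule order_trans)
    then show ?thesis using ereal_uminus_le_reorder by auto
  qed
  then have "- liminf (?l U) \<le> (INF x\<in>interior U. I x)" by (rule INF_greatest)
  then show "- (INF x\<in>interior U. I x) \<le> liminf (?l U)" using ereal_uminus_le_reorder by auto
  show "limsup (?l U) \<le> - (INF x\<in>closure U. I x)" by (rule limsup_le[OF U])
qed (use measurable_Y good_rate_function_I in auto)

end

section \<open>The Markov chain\<close>

lemma marginal_step:
  fixes Z Z' :: "'w \<Rightarrow> int" and s :: real
  assumes "prob_space M"
    and meas: "Z \<in> measurable M (count_space UNIV)" "Z' \<in> measurable M (count_space UNIV)"
    and up: "\<And>z. \<P>(\<omega> in M. Z \<omega> = z) > 0 \<Longrightarrow>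
      \<P>(\<omega> in M. Z' \<omega> - Z \<omega> = 1 \<bar> Z \<omega> = z) = 1 - real_of_int z / s"
    and stay: "\<And>z. \<P>(\<omega> in M. Z \<omega> = z) > 0 \<Longrightarrow>
      \<P>(\<omega> in M. Z' \<omega> - Z \<omega> = 0 \<bar> Z \<omega> = z) = real_of_int z / s"
  shows "\<P>(\<omega> in M. Z' \<omega> = k) = (1 - real_of_int (k - 1) / s) * \<P>(\<omega> in M. Z \<omega> = k - 1)
    + real_of_int k / s * \<P>(\<omega> in M. Z \<omega> = k)"
proof -
  interpret prob_space M by fact
  note [measurable] = meas
  have joint: "\<P>(\<omega> in M. Z' \<omega> - Z \<omega> = 1 \<and> Z \<omega> = z) = (1 - real_of_int z / s) * \<P>(\<omega> in M. Z \<omega> = z)"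
    "\<P>(\<omega> in M. Z' \<omega> - Z \<omega> = 0 \<and> Z \<omega> = z) = real_of_int z / s * \<P>(\<omega> in M. Z \<omega> = z)" for z
  proof -
    have le: "\<P>(\<omega> in M. Z' \<omega> - Z \<omega> = c \<and> Z \<omega> = z) \<le> \<P>(\<omega> in M. Z \<omega> = z)" for c
      by (intro finite_measure_mono) auto
    show "\<P>(\<omega> in M. Z' \<omega> - Z \<omega> = 1 \<and> Z \<omega> = z) = (1 - real_of_int z / s) * \<P>(\<omega> in M. Z \<omega> = z)"
    proof (cases "\<P>(\<omega> in M. Z \<omega> = z) > 0")
      case True
      then show ?thesis using up[OF True] unfolding cond_prob_def by (simp add: divide_eq_eq)
    next
      case False
      then have "\<P>(\<omega> in M. Z \<omega> = z) = 0" using measure_nonneg[of M] by (simp add: not_less order_antisym)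
      then show ?thesis using le[of 1] measure_nonneg[of M] by (simp add: order_antisym)
    qed
    show "\<P>(\<omega> in M. Z' \<omega> - Z \<omega> = 0 \<and> Z \<omega> = z) = real_of_int z / s * \<P>(\<omega> in M. Z \<omega> = z)"
    proof (cases "\<P>(\<omega> in M. Z \<omega> = z) > 0")
      case True
      then show ?thesis using stay[OF True] unfolding cond_prob_def by (simp add: divide_eq_eq)
    next
      case False
      then have "\<P>(\<omega> in M. Z \<omega> = z) = 0" using measure_nonneg[of M] by (simp add: not_less order_antisym)
      then show ?thesis using le[of 0] measure_nonneg[of M] by (simp add: order_antisym)
    qed
  qed
  \<comment> \<open>The two prescribed probabilities add up to 1, so other increments form a null
    set for each of the countably many states. Only then do the events \<open>?A\<close> and
    \<open>?B\<close> below exhaust the event that \<open>Z'\<close> takes the value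
    \<open>k\<close>.\<close>
  have "AE \<omega> in M. \<forall>z. \<not> (Z \<omega> = z \<and> Z' \<omega> - Z \<omega> \<noteq> 0 \<and> Z' \<omega> - Z \<omega> \<noteq> 1)"
    unfolding AE_all_countable
  proof
    fix z
    let ?A = "{\<omega> \<in> space M. Z' \<omega> - Z \<omega> = 1 \<and> Z \<omega> = z}" and ?B = "{\<omega> \<in> space M. Z' \<omega> - Z \<omega> = 0 \<and> Z \<omega> = z}"
    let ?C = "{\<omega> \<in> space M. Z \<omega> = z \<and> Z' \<omega> - Z \<omega> \<noteq> 0 \<and> Z' \<omega> - Z \<omega> \<noteq> 1}"
    have "\<P>(\<omega> in M. Z \<omega> = z) = prob (?A \<union> (?B \<union> ?C))" by (rule arg_cong[where f = prob]) auto
    also have "\<dots> = prob ?A + prob (?B \<union> ?C)" by (rule finite_measure_Union) auto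
    also have "prob (?B \<union> ?C) = prob ?B + prob ?C" by (rule finite_measure_Union) auto
    finally have "prob ?C = 0" unfolding joint by (simp add: algebra_simps)
    then show "AE \<omega> in M. \<not> (Z \<omega> = z \<and> Z' \<omega> - Z \<omega> \<noteq> 0 \<and> Z' \<omega> - Z \<omega> \<noteq> 1)"
      by (subst (asm) prob_Collect_eq_0) auto
  qed
  then have ae: "AE \<omega> in M. Z' \<omega> - Z \<omega> = 0 \<or> Z' \<omega> - Z \<omega> = 1" by eventually_elim blast
  let ?A = "{\<omega> \<in> space M. Z' \<omega> - Z \<omega> = 1 \<and> Z \<omega> = k - 1}" and ?B = "{\<omega> \<in> space M. Z' \<omega> - Z \<omega> = 0 \<and> Z \<omega> = k}"
  have "\<P>(\<omega> in M. Z' \<omega> = k) = prob (?A \<union> ?B)"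
    by (rule finite_measure_eq_AE) (use ae in \<open>eventually_elim, auto\<close>)
  also have "\<dots> = prob ?A + prob ?B" by (rule finite_measure_Union) auto
  finally show ?thesis unfolding joint .
qed

lemma marginal_eq_weight:
  fixes Z :: "nat \<Rightarrow> 'w \<Rightarrow> int" and s :: "nat \<Rightarrow> real"
  assumes "prob_space M"
    and meas: "\<And>n. n \<ge> 1 \<Longrightarrow> Z n \<in> measurable M (count_space UNIV)"
    and init: "AE \<omega> in M. Z 1 \<omega> = int k0"
    and up: "\<And>n z. n \<ge> 1 \<Longrightarrow> \<P>(\<omega> in M. Z n \<omega> = z) > 0 \<Longrightarrow>
           \<P>(\<omega> in M. Z (n + 1) \<omega> - Z n \<omega> = 1 \<bar> Z n \<omega> = z) = 1 - real_of_int z / s n"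
    and stay: "\<And>n z. n \<ge> 1 \<Longrightarrow> \<P>(\<omega> in M. Z n \<omega> = z) > 0 \<Longrightarrow>
           \<P>(\<omega> in M. Z (n + 1) \<omega> - Z n \<omega> = 0 \<bar> Z n \<omega> = z) = real_of_int z / s n"
  shows "\<P>(\<omega> in M. Z (Suc n) \<omega> = k) = (if 0 \<le> k then weight (\<lambda>n. s (Suc n)) k0 n (nat k) else 0)"
proof (induction n arbitrary: k)
  case 0
  interpret prob_space M by fact
  note [measurable] = meas[of 1, simplified]
  have "\<P>(\<omega> in M. Z (Suc 0) \<omega> = k) = \<P>(\<omega> in M. int k0 = k)"
    by (rule finite_measure_eq_AE) (use init in \<open>eventually_elim, auto\<close>)
  then show ?case by (cases "int k0 = k") (auto simp: prob_space)
next
  case (Suc n)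
  have step: "\<P>(\<omega> in M. Z (Suc (Suc n)) \<omega> = k)
    = (1 - real_of_int (k - 1) / s (Suc n)) * \<P>(\<omega> in M. Z (Suc n) \<omega> = k - 1)
    + real_of_int k / s (Suc n) * \<P>(\<omega> in M. Z (Suc n) \<omega> = k)"
    using up[of "Suc n"] stay[of "Suc n"] meas[of "Suc n"] meas[of "Suc (Suc n)"]
    by (intro marginal_step[OF \<open>prob_space M\<close>]) auto
  show ?case
  proof (cases "k \<le> 0")
    \<comment> \<open>For \<open>k \<le> 0\<close> the predecessor \<open>k - 1\<close> is negative
      and carries no mass; staying at 0 has probability 0.\<close>
    case True
    then show ?thesis unfolding step Suc by auto
  next
    case False
    then obtain j where "k = int (Suc j)" by (metis gr0_implies_Suc not_le zero_less_imp_eq_int)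
    then show ?thesis unfolding step Suc by (simp add: nat_add_distrib)
  qed
qed

lemma mgf_eq_finite_sum:
  fixes X :: "'w \<Rightarrow> int" and p :: "nat \<Rightarrow> real"
  assumes "prob_space M" and [measurable]: "X \<in> measurable M (count_space UNIV)"
    and p: "\<And>k. \<P>(\<omega> in M. X \<omega> = k) = (if 0 \<le> k then p (nat k) else 0)"
    and supp: "\<And>k. N < k \<Longrightarrow> p k = 0"
  shows "integrable M (\<lambda>\<omega>. exp (\<theta> * real_of_int (X \<omega>)))"
    and "(\<integral>\<omega>. exp (\<theta> * real_of_int (X \<omega>)) \<partial>M) = (\<Sum>k\<le>N. p k * exp (real k * \<theta>))"
proof -
  interpret prob_space M by fact
  let ?A = "\<lambda>k. {\<omega> \<in> space M. X \<omega> = int k}"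
  let ?f = "\<lambda>\<omega>. exp (\<theta> * real_of_int (X \<omega>))"
  let ?g = "\<lambda>\<omega>. \<Sum>k\<le>N. exp (real k * \<theta>) * indicator (?A k) \<omega>"
  have "AE \<omega> in M. \<forall>k. k \<notin> int ` {..N} \<longrightarrow> X \<omega> \<noteq> k"
    unfolding AE_all_countable
  proof
    fix k
    show "AE \<omega> in M. k \<notin> int ` {..N} \<longrightarrow> X \<omega> \<noteq> k"
    proof (cases "k \<in> int ` {..N}")
      case False
      have "\<P>(\<omega> in M. X \<omega> = k) = 0"
      proof (cases "0 \<le> k")
        case True
        then have "N < nat k" using False by (metis atMost_iff image_eqI int_nat_eq not_le)
        then show ?thesis using p[of k] supp by simp
      qed (simp add: p)
      then show ?thesis by (subst (asm) prob_Collect_eq_0) auto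
    qed simp
  qed
  then have ae: "AE \<omega> in M. ?f \<omega> = ?g \<omega>"
    using AE_space
  proof eventually_elim
    case (elim \<omega>)
    then obtain k where k: "k \<le> N" "X \<omega> = int k" by blast
    have "?g \<omega> = (\<Sum>j\<le>N. if j = k then exp (real k * \<theta>) else 0)"
      using elim k by (intro sum.cong) auto
    then show ?case using k by (simp add: mult.commute)
  qed
  have int: "integrable M (\<lambda>\<omega>. exp (real k * \<theta>) * indicator (?A k) \<omega> :: real)" for k
    by (intro integrable_mult_right integrable_real_indicator) (auto simp: emeasure_eq_measure)
  have X: "(\<lambda>\<omega>. real_of_int (X \<omega>)) \<in> borel_measurable M"
    by (rule measurable_compose[OF assms(2)]) simp
  have "integrable M ?g" by (intro Bochner_Integration.integrable_sum int)
  then show "integrable M ?f"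
    by (rule integrable_cong_AE_imp) (use ae X in auto)
  have "(\<integral>\<omega>. ?f \<omega> \<partial>M) = (\<integral>\<omega>. ?g \<omega> \<partial>M)"
    using X ae by (intro integral_cong_AE) auto
  also have "\<dots> = (\<Sum>k\<le>N. \<integral>\<omega>. exp (real k * \<theta>) * indicator (?A k) \<omega> \<partial>M)"
    by (rule Bochner_Integration.integral_sum) (rule int)
  also have "\<dots> = (\<Sum>k\<le>N. p k * exp (real k * \<theta>))"
  proof (rule sum.cong)
    fix k
    have "?A k \<inter> space M = ?A k" by auto
    then show "(\<integral>\<omega>. exp (real k * \<theta>) * indicator (?A k) \<omega> \<partial>M) = p k * exp (real k * \<theta>)"
      using p[of "int k"] by simp
  qed simp
  finally show "(\<integral>\<omega>. ?f \<omega> \<partial>M) = (\<Sum>k\<le>N. p k * exp (real k * \<theta>))" .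
qed

text \<open>The limit equation required by \<open>upwind_limit\<close> is
  \<open>beta_transform_ode\<close> divided by \<open>beta_transform \<alpha> x\<close>: the step
  factor becomes the reciprocal of the transform.\<close>

lemma ln_exp_moment_limit:
  fixes s :: "nat \<Rightarrow> real" and k0 :: nat and \<alpha> x :: real
  assumes "1 < \<alpha>" and s: "\<And>n. 0 < s n" "\<And>n. real (k0 + n) \<le> s n" "(\<lambda>n. s n / real n) \<longlonglongrightarrow> \<alpha>"
  shows "(\<lambda>n. ln (exp_moment s k0 0 n x) / real n) \<longlonglongrightarrow> - ln (beta_transform \<alpha> x)"
proof (rule upwind_limit[where x = x and s = s and L = "\<lambda>n x. ln (exp_moment s k0 0 n x)" and v = "tilted_mean s k0"
    and \<Lambda> = "\<lambda>x. - ln (beta_transform \<alpha> x)" and D = "\<lambda>x. - beta_transform_deriv \<alpha> x / beta_transform \<alpha> x"])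
  note F = beta_transform_pos[OF assms(1)] beta_transform_has_derivative[OF assms(1)]
  fix x
  show "((\<lambda>x. - ln (beta_transform \<alpha> x)) has_real_derivative - beta_transform_deriv \<alpha> x / beta_transform \<alpha> x) (at x)"
    using F(1)[of x] by (auto intro!: derivative_eq_intros F(2))
  show "0 \<le> - beta_transform_deriv \<alpha> x / beta_transform \<alpha> x"
    using F(1)[of x] beta_transform_deriv_bounds(1)[OF assms(1), of x] by (intro divide_nonneg_pos) auto
  show "- beta_transform_deriv \<alpha> x / beta_transform \<alpha> x \<le> 1"
    using F(1)[of x] beta_transform_deriv_bounds(2)[OF assms(1), of x] by (simp add: field_simps)
  have "beta_transform_deriv \<alpha> x / beta_transform \<alpha> x / \<alpha> * beta_transform \<alpha> x = beta_transform_deriv \<alpha> x / \<alpha>"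
    using F(1)[of x] by simp
  then have "step_factor x (- beta_transform_deriv \<alpha> x / beta_transform \<alpha> x / \<alpha>) * beta_transform \<alpha> x
      = exp x * beta_transform \<alpha> x + (exp x - 1) * (beta_transform_deriv \<alpha> x / \<alpha>)"
    unfolding step_factor_def left_diff_distrib using F(1)[of x] by (simp add: mult.assoc)
  then have "step_factor x (- beta_transform_deriv \<alpha> x / beta_transform \<alpha> x / \<alpha>) * beta_transform \<alpha> x = 1"
    using beta_transform_ode[OF assms(1), of x] by simp
  then have "step_factor x (- beta_transform_deriv \<alpha> x / beta_transform \<alpha> x / \<alpha>) = inverse (beta_transform \<alpha> x)"
    using F(1)[of x] by (simp add: field_simps)
  then show "- ln (beta_transform \<alpha> x) = ln (step_factor x (- beta_transform_deriv \<alpha> x / beta_transform \<alpha> x / \<alpha>))"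
    using F(1)[of x] by (simp add: ln_inverse)
next
  have "continuous_on UNIV (beta_transform \<alpha>)"
    using beta_transform_has_derivative[OF assms(1)] by (meson DERIV_continuous_on has_field_derivative_at_within)
  then show "continuous_on UNIV (\<lambda>x. - beta_transform_deriv \<alpha> x / beta_transform \<alpha> x)"
    using beta_transform_pos[OF assms(1)] by (intro continuous_intros continuous_beta_transform_deriv assms(1)) (auto simp: less_imp_neq[THEN not_sym])
next
  show "real n \<le> s n" for n using s(2)[of n] by simp
qed (use assms ln_exp_moment_deriv ln_exp_moment_0 tilted_mean_bounds tilted_mean_lipschitz ln_exp_moment_Suc beta_transform_0
    in \<open>auto simp: step_factor_def\<close>)

theorem theorem1p1:
  fixes \<alpha> :: real and k0 :: nat and s :: "nat \<Rightarrow> real"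
    and M :: "'w measure" and Z :: "nat \<Rightarrow> 'w \<Rightarrow> int"
    and \<Lambda> :: "real \<Rightarrow> real" and I :: "real \<Rightarrow> ereal"
  defines "\<Lambda> \<equiv> pressure M (\<lambda>n \<omega>. real_of_int (Z n \<omega>))"
    and "I \<equiv> legendre_transform \<Lambda>"
  assumes "1 < \<alpha>"
    and "\<And>n. n \<ge> 1 \<Longrightarrow> s n > 0"
    and "\<And>n. n \<ge> 1 \<Longrightarrow> s n \<ge> real k0 + real n - 1"
    and "(\<lambda>n. s n / real n) \<longlonglongrightarrow> \<alpha>"
    and "markov_chain M Z"
    and "AE \<omega> in M. Z 1 \<omega> = int k0"
    and "\<And>n z. n \<ge> 1 \<Longrightarrow> \<P>(\<omega> in M. Z n \<omega> = z) > 0 \<Longrightarrow>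
           \<P>(\<omega> in M. Z (n + 1) \<omega> - Z n \<omega> = 1 \<bar> Z n \<omega> = z) = 1 - real_of_int z / s n"
    and "\<And>n z. n \<ge> 1 \<Longrightarrow> \<P>(\<omega> in M. Z n \<omega> = z) > 0 \<Longrightarrow>
           \<P>(\<omega> in M. Z (n + 1) \<omega> - Z n \<omega> = 0 \<bar> Z n \<omega> = z) = real_of_int z / s n"
  shows "large_deviation_principle M (\<lambda>n \<omega>. real_of_int (Z n \<omega>) / real n) I
    \<and> strictly_convex_where_finite I
    \<and> (\<forall>\<theta>. (\<forall>n\<ge>1. integrable M (\<lambda>\<omega>. exp (\<theta> * real_of_int (Z n \<omega>))))
         \<and> convergent (scaled_log_mgf M (\<lambda>n \<omega>. real_of_int (Z n \<omega>)) \<theta>))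
    \<and> (\<forall>\<theta>. \<theta> \<noteq> 0 \<longrightarrow>
         \<Lambda> \<theta> = - ln (\<alpha> / (exp \<theta> - 1) *
                    (LBINT t=0..ereal \<theta>. ((exp t - 1) / (exp \<theta> - 1)) powr (\<alpha> - 1))))
    \<and> \<Lambda> 0 = 0"
proof -
  note \<alpha> = \<open>1 < \<alpha>\<close>
  \<comment> \<open>Time now starts at 0: \<open>s n \<ge> k0 + n - 1\<close> becomes
    \<open>k0 + n \<le> s' n\<close>, and the law of \<open>Z (Suc n)\<close> is
    \<open>weight s' k0 n\<close>.\<close>
  define s' where "s' n = s (Suc n)" for n
  define Y where "Y n \<omega> = real_of_int (Z n \<omega>)" for n \<omega>
  have ps: "prob_space M" and meas: "\<And>n. n \<ge> 1 \<Longrightarrow> Z n \<in> measurable M (count_space UNIV)"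
    using \<open>markov_chain M Z\<close> by (auto simp: markov_chain_def)
  have s': "0 < s' n" "real (k0 + n) \<le> s' n" for n
    using assms(4)[of "Suc n"] assms(5)[of "Suc n"] by (simp_all add: s'_def)
  have s'_lim: "(\<lambda>n. s' n / real n) \<longlonglongrightarrow> \<alpha>"
  proof -
    have "(\<lambda>n. s (Suc n) / real (Suc n)) \<longlonglongrightarrow> \<alpha>" using assms(6) by (rule LIMSEQ_Suc)
    moreover have "(\<lambda>n. real (Suc n) / real n) \<longlonglongrightarrow> 1" by real_asymp
    ultimately have "(\<lambda>n. s (Suc n) / real (Suc n) * (real (Suc n) / real n)) \<longlonglongrightarrow> \<alpha> * 1"
      by (rule tendsto_mult)
    then show ?thesis by (simp add: s'_def del: of_nat_Suc)
  qed
  note marginal = marginal_eq_weight[OF ps meas assms(8-10), folded s'_def]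
  have supp: "weight s' k0 n k = 0" if "k0 + n < k" for n k using that by (rule weight_support)
  have mgf: "integrable M (\<lambda>\<omega>. exp (\<theta> * Y (Suc n) \<omega>))"
    "(\<integral>\<omega>. exp (\<theta> * Y (Suc n) \<omega>) \<partial>M) = exp_moment s' k0 0 n \<theta>" for n \<theta>
  proof -
    have "Z (Suc n) \<in> measurable M (count_space UNIV)" by (rule meas) simp
    note sum = mgf_eq_finite_sum[where N = "k0 + n" and \<theta> = \<theta>, OF ps this marginal supp, simplified]
    show "integrable M (\<lambda>\<omega>. exp (\<theta> * Y (Suc n) \<omega>))" unfolding Y_def by (rule sum(1))
    show "(\<integral>\<omega>. exp (\<theta> * Y (Suc n) \<omega>) \<partial>M) = exp_moment s' k0 0 n \<theta>"
      unfolding Y_def sum(2) by (simp add: exp_moment_def)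
  qed
  have lim: "scaled_log_mgf M Y \<theta> \<longlonglongrightarrow> - ln (beta_transform \<alpha> \<theta>)" for \<theta>
  proof (rule LIMSEQ_imp_Suc)
    have "(\<lambda>n. ln (exp_moment s' k0 0 n \<theta>) / real n) \<longlonglongrightarrow> - ln (beta_transform \<alpha> \<theta>)"
      by (rule ln_exp_moment_limit[OF \<alpha> s' s'_lim])
    \<comment> \<open>Corrects the normalization, since the moment with index \<open>n\<close>
      belongs to \<open>Z (Suc n)\<close>.\<close>
    moreover have "(\<lambda>n. real n / real (Suc n)) \<longlonglongrightarrow> 1" by real_asymp
    ultimately have "(\<lambda>n. ln (exp_moment s' k0 0 n \<theta>) / real n * (real n / real (Suc n))) \<longlonglongrightarrow> - ln (beta_transform \<alpha> \<theta>) * 1"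
      by (rule tendsto_mult)
    moreover have "\<forall>\<^sub>F n in sequentially. ln (exp_moment s' k0 0 n \<theta>) / real n * (real n / real (Suc n))
        = scaled_log_mgf M Y \<theta> (Suc n)"
      using eventually_ge_at_top[of 1] by eventually_elim (simp add: scaled_log_mgf_def mgf)
    ultimately show "(\<lambda>n. scaled_log_mgf M Y \<theta> (Suc n)) \<longlonglongrightarrow> - ln (beta_transform \<alpha> \<theta>)"
      by (simp add: tendsto_cong)
  qed
  \<comment> \<open>\<open>pressure\<close> is defined by \<open>lim\<close>, so it acquires its
    value only through the convergence just shown.\<close>
  have \<Lambda>: "\<Lambda> = (\<lambda>\<theta>. - ln (beta_transform \<alpha> \<theta>))"
    unfolding \<Lambda>_def pressure_def Y_def[symmetric, abs_def] using limI[OF lim] by blast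
  interpret gaertner_ellis M Y \<Lambda> "\<lambda>x. - beta_transform_deriv \<alpha> x / beta_transform \<alpha> x"
  proof (intro gaertner_ellis.intro gaertner_ellis_axioms.intro ps)
    fix n :: nat and \<theta> :: real
    show "Y n \<in> borel_measurable M" if "1 \<le> n"
      unfolding Y_def by (rule measurable_compose[OF meas[OF that]]) simp
    show "integrable M (\<lambda>\<omega>. exp (\<theta> * Y n \<omega>))" if "1 \<le> n"
      using mgf(1)[of \<theta> "n - 1"] that by simp
    show "scaled_log_mgf M Y \<theta> \<longlonglongrightarrow> \<Lambda> \<theta>" unfolding \<Lambda> by (rule lim)
    show "(\<Lambda> has_real_derivative - beta_transform_deriv \<alpha> \<theta> / beta_transform \<alpha> \<theta>) (at \<theta>)"
      unfolding \<Lambda> using beta_transform_pos[OF \<alpha>, of \<theta>]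
      by (auto intro!: derivative_eq_intros beta_transform_has_derivative[OF \<alpha>])
  qed
  have "convergent (scaled_log_mgf M Y \<theta>)" for \<theta> using lim by (auto simp: convergent_def)
  moreover have "\<Lambda> \<theta> = - ln (\<alpha> / (exp \<theta> - 1) *
      (LBINT t=0..ereal \<theta>. ((exp t - 1) / (exp \<theta> - 1)) powr (\<alpha> - 1)))" if "\<theta> \<noteq> 0" for \<theta>
    unfolding \<Lambda> beta_transform_eq_interval_integral[OF \<alpha> that] ..
  ultimately show ?thesis
    using large_deviation_principle_I strictly_convex_I integrable_exp limit_0
    unfolding I_def Y_def by blast
qed

end
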